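(* Let $A=(a_{ij})\in D_n$ (respectively, $A\in GD_n$) with $a_{ii}\neq 0$ for all $i\in\{1,\dots,n\}$. Then $\rho(H_{BGS})<1$ (i.e., the sequence $\{x^{(i)}\}$ generated by the BGS scheme converges to the unique solution of $Ax=b$ for any choice of the initial guess $x^{(0)}$) if and only if both of the following hold: (i) $A$ has no $2\times 2$ irreducible principal submatrix belonging to $DE_2$ (respectively, $GDE_2$); (ii) $A$ has no irreducible principal submatrix $A_k=A(i_1,i_2,\dots,i_k)$, $3\le k\le n$, such that $D_{A_k}^{-1}A_k\in \mathscr{L}^{\phi}_k\cap DE_k$ (respectively, $D_{A_k}^{-1}A_k\in\mathscr{L}^{\phi}_k\cap GDE_k$) for some $\phi\in\mathbb{R}$, where $D_{A_k}=\mathrm{diag}(a_{i_1i_1},a_{i_2i_2},\dots,a_{i_ki_k})$.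
   Context: For complex $n\times n$ matrices $A=(a_{ij})$: $A\in D_n$ (diagonally dominant by row) if $|a_{ii}|\ge\sum_{j\ne i}|a_{ij}|$ for all $i$; $A\in DE_n$ (diagonally equipotent) if equality holds for all $i$; $A\in GD_n$ (generalized diagonally dominant) if there are positive constants $\alpha_1,\dots,\alpha_n$ with $\alpha_i|a_{ii}|\ge\sum_{j\ne i}\alpha_j|a_{ij}|$ for all $i$; $A\in GDE_n$ (generalized diagonally equipotent) if such constants exist with equality for all $i$. $A(i_1,\dots,i_k)$, $i_1<\dots<i_k$, is the principal submatrix of $A$ with rows and columns $i_1,\dots,i_k$. Write $A=D_A-L_A-U_A$ with $D_A=\mathrm{diag}(a_{11},\dots,a_{nn})$, $L_A$ strictly lower triangular, $U_A$ strictly upper triangular. The backward Gauss-Seidel (BGS) iteration matrix is $H_{BGS}=(D_A-U_A)^{-1}L_A$, and the BGS scheme for $Ax=b$ is $x^{(i+1)}=H_{BGS}x^{(i)}+(D_A-U_A)^{-1}b$, $i=0,1,2,\dots$. $\rho$ denotes the spectral radius. A matrix $(e^{i\phi_{rs}})\in\mathbb{C}^{k\times k}$ ($\phi_{rs}\in\mathbb{R}$, $i=\sqrt{-1}$) is a $\phi$-ray pattern matrix ($\phi\in\mathbb{R}$) if, modulo $2\pi$: (1) $\phi_{rs}+\phi_{sr}\equiv\phi$ for all $r\ne s$; (2) $\phi_{rs}-\phi_{rt}\equiv\phi_{ts}-\phi+\pi$ whenever $r<s<t$ or $s<t<r$ or $t<r<s$; (3) $\phi_{rs}-\phi_{rt}\equiv\phi_{ts}+\pi$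 whenever $r<t<s$ or $t<s<r$ or $s<r<t$; (4) $\phi_{rr}=0$ for all $r$. $\mathscr{L}^{\phi}_k$ is the set of $k\times k$ complex matrices $B=(b_{rs})$ for which there exist $\eta\in\mathbb{R}$ and a $\phi$-ray pattern matrix $(e^{i\phi_{rs}})$ with $b_{rs}=e^{i\eta}|b_{rs}|e^{i\phi_{rs}}$ for all $r,s$. *)

theory Defs
  imports
    "Jordan_Normal_Form.Spectral_Radius"
    "Jordan_Normal_Form.Gauss_Jordan_Elimination"
    "Jordan_Normal_Form.DL_Submatrix"
    "HOL-Combinatorics.Permutations"
    "HOL-Library.Real_Mod"
begin

text \<open>
  All row and column indices are shifted to start at 0. The principal submatrix
  $A(i_1,\dots,i_k)$ is \<open>submatrix A I I\<close> with \<open>I = {i_1, \<dots>, i_k}\<close>: \<^const>\<open>submatrix\<close> lists the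
  elements of \<open>I\<close> in increasing order.
\<close>

definition D_mats :: "nat \<Rightarrow> complex mat set" where
  "D_mats n = {A \<in> carrier_mat n n.
     \<forall>i<n. cmod (A $$ (i,i)) \<ge> (\<Sum>j\<in>{..<n} - {i}. cmod (A $$ (i,j)))}"

definition DE_mats :: "nat \<Rightarrow> complex mat set" where
  "DE_mats n = {A \<in> carrier_mat n n.
     \<forall>i<n. cmod (A $$ (i,i)) = (\<Sum>j\<in>{..<n} - {i}. cmod (A $$ (i,j)))}"

definition GD_mats :: "nat \<Rightarrow> complex mat set" where
  "GD_mats n = {A \<in> carrier_mat n n. \<exists>\<alpha> :: nat \<Rightarrow> real. (\<forall>i<n. \<alpha> i > 0) \<and>
     (\<forall>i<n. \<alpha> i * cmod (A $$ (i,i)) \<ge> (\<Sum>j\<in>{..<n} - {i}. \<alpha> j * cmod (A $$ (i,j))))}"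

definition GDE_mats :: "nat \<Rightarrow> complex mat set" where
  "GDE_mats n = {A \<in> carrier_mat n n. \<exists>\<alpha> :: nat \<Rightarrow> real. (\<forall>i<n. \<alpha> i > 0) \<and>
     (\<forall>i<n. \<alpha> i * cmod (A $$ (i,i)) = (\<Sum>j\<in>{..<n} - {i}. \<alpha> j * cmod (A $$ (i,j))))}"

text \<open>
  A square matrix is reducible if $P A P^T$ is block upper triangular, with two nonempty square
  diagonal blocks, for some permutation matrix \<open>P\<close>; for the permutation \<open>p\<close> that \<open>P\<close>
  represents, the entries of $P A P^T$ are \<open>A $$ (p i, p j)\<close>. By this definition every 1-by-1
  matrix is irreducible; only orders at least 2 are used below.
\<close>

definition reducible_mat :: "complex mat \<Rightarrow> bool" where
  "reducible_mat A \<longleftrightarrow> (\<exists>n r p A11 A12 A22.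
     A \<in> carrier_mat n n \<and> 0 < r \<and> r < n \<and> p permutes {..<n} \<and>
     A11 \<in> carrier_mat r r \<and> A12 \<in> carrier_mat r (n - r) \<and> A22 \<in> carrier_mat (n - r) (n - r) \<and>
     mat n n (\<lambda>(i,j). A $$ (p i, p j)) = four_block_mat A11 A12 (0\<^sub>m (n - r) r) A22)"

definition irreducible_mat :: "complex mat \<Rightarrow> bool" where
  "irreducible_mat A \<longleftrightarrow> square_mat A \<and> \<not> reducible_mat A"

definition diag_part :: "complex mat \<Rightarrow> complex mat" where
  "diag_part A = mat_diag (dim_row A) (\<lambda>i. A $$ (i,i))"

text \<open>The signs follow the splitting $A = D_A - L_A - U_A$.\<close>

definition lower_part :: "complex mat \<Rightarrow> complex mat" where
  "lower_part A = mat (dim_row A) (dim_col A) (\<lambda>(i,j). if j < i then - (A $$ (i,j)) else 0)"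

definition upper_part :: "complex mat \<Rightarrow> complex mat" where
  "upper_part A = mat (dim_row A) (dim_col A) (\<lambda>(i,j). if i < j then - (A $$ (i,j)) else 0)"

lemma DLU_splitting:
  assumes "A \<in> carrier_mat n n"
  shows "A = diag_part A - lower_part A - upper_part A"
  using assms by (intro eq_matI) (auto simp: diag_part_def lower_part_def upper_part_def mat_diag_def)

text \<open>Meaningful for invertible arguments only.\<close>

abbreviation inv_mat :: "complex mat \<Rightarrow> complex mat" where
  "inv_mat M \<equiv> the (mat_inverse M)"

definition H_BGS :: "complex mat \<Rightarrow> complex mat" where
  "H_BGS A = inv_mat (diag_part A - upper_part A) * lower_part A"

primrec bgs_iter :: "complex mat \<Rightarrow> complex vec \<Rightarrow> complex vec \<Rightarrow> nat \<Rightarrow> complex vec" where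
  "bgs_iter A b x0 0 = x0"
| "bgs_iter A b x0 (Suc i) =
     H_BGS A *\<^sub>v bgs_iter A b x0 i + inv_mat (diag_part A - upper_part A) *\<^sub>v b"

text \<open>The type \<open>vec\<close> carries no topology, so limits are taken entrywise.\<close>

definition vec_tendsto :: "nat \<Rightarrow> (nat \<Rightarrow> complex vec) \<Rightarrow> complex vec \<Rightarrow> bool" where
  "vec_tendsto n X x \<longleftrightarrow> (\<forall>j<n. (\<lambda>i. X i $ j) \<longlonglongrightarrow> x $ j)"

definition bgs_convergent :: "nat \<Rightarrow> complex mat \<Rightarrow> complex vec \<Rightarrow> bool" where
  "bgs_convergent n A b \<longleftrightarrow>
     (\<exists>x\<in>carrier_vec n. A *\<^sub>v x = b \<and> (\<forall>y\<in>carrier_vec n. A *\<^sub>v y = b \<longrightarrow> y = x) \<and>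
        (\<forall>x0\<in>carrier_vec n. vec_tendsto n (bgs_iter A b x0) x))"

text \<open>
  The disjunctions list the cyclic orders of \<open>(r, s, t)\<close> and \<open>(r, t, s)\<close>, respectively.
\<close>

definition ray_pattern :: "real \<Rightarrow> nat \<Rightarrow> complex mat \<Rightarrow> bool" where
  "ray_pattern \<phi> k P \<longleftrightarrow> (\<exists>\<theta> :: nat \<Rightarrow> nat \<Rightarrow> real.
     P = mat k k (\<lambda>(r,s). cis (\<theta> r s)) \<and>
     (\<forall>r<k. \<forall>s<k. r \<noteq> s \<longrightarrow> [\<theta> r s + \<theta> s r = \<phi>] (rmod (2 * pi))) \<and>
     (\<forall>r<k. \<forall>s<k. \<forall>t<k. r < s \<and> s < t \<or> s < t \<and> t < r \<or> t < r \<and> r < s \<longrightarrow>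
        [\<theta> r s - \<theta> r t = \<theta> t s - \<phi> + pi] (rmod (2 * pi))) \<and>
     (\<forall>r<k. \<forall>s<k. \<forall>t<k. r < t \<and> t < s \<or> t < s \<and> s < r \<or> s < r \<and> r < t \<longrightarrow>
        [\<theta> r s - \<theta> r t = \<theta> t s + pi] (rmod (2 * pi))) \<and>
     (\<forall>r<k. \<theta> r r = 0))"

definition L_ray :: "real \<Rightarrow> nat \<Rightarrow> complex mat set" where
  "L_ray \<phi> k = {B \<in> carrier_mat k k. \<exists>(\<eta> :: real) P. ray_pattern \<phi> k P \<and>
     (\<forall>r<k. \<forall>s<k. B $$ (r,s) = cis \<eta> * of_real (cmod (B $$ (r,s))) * P $$ (r,s))}"

end

theory Submission imports Defs
begin

text \<open>
  A number \<open>\<mu> \<noteq> 0\<close> is an eigenvalue of the iteration matrix iff \<open>A\<close>, with its strictly lower part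
  multiplied by \<open>1 / \<mu>\<close>, is singular. If \<open>\<bar>\<mu>\<bar> \<ge> 1\<close>, this twisted matrix is still generalized diagonally
  dominant with the weights \<open>\<alpha>\<close> of \<open>A\<close>. On the rows where a null vector \<open>v\<close> maximizes \<open>\<bar>v i\<bar> / \<alpha> i\<close>,
  all inequalities of Gershgorin's argument become equalities: these rows meet no other column,
  dominance is an equality there, \<open>\<bar>\<mu>\<bar> = 1\<close>, and the phases of the entries are determined by \<open>\<mu>\<close> and the
  phases of \<open>v\<close>, which is exactly the ray pattern condition with \<open>cis \<phi> = \<mu>\<close>. Conversely, phases and
  weights of an equipotent ray pattern component yield a null vector of the corresponding block of
  the matrix twisted by \<open>cis (- \<phi>)\<close>; this block has no entries to its side, so the whole twisted matrix is
  singular. For blocks of order two the phase condition always holds for a suitable \<open>\<phi>\<close>.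
\<close>

section \<open>Equality in diagonal dominance\<close>

text \<open>Entries are given as a function and the index set is arbitrary, so a principal submatrix
  is the same function on a smaller set and no renumbering enters the analytic part.\<close>

definition dominant_on :: "(nat \<Rightarrow> nat \<Rightarrow> complex) \<Rightarrow> (nat \<Rightarrow> real) \<Rightarrow> nat set \<Rightarrow> bool" where
  "dominant_on a \<alpha> I \<longleftrightarrow> (\<forall>i\<in>I. \<alpha> i * cmod (a i i) \<ge> (\<Sum>j\<in>I - {i}. \<alpha> j * cmod (a i j)))"

definition equi_on :: "(nat \<Rightarrow> nat \<Rightarrow> complex) \<Rightarrow> (nat \<Rightarrow> real) \<Rightarrow> nat set \<Rightarrow> bool" where
  "equi_on a \<alpha> I \<longleftrightarrow> (\<forall>i\<in>I. \<alpha> i * cmod (a i i) = (\<Sum>j\<in>I - {i}. \<alpha> j * cmod (a i j)))"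

text \<open>Strong connectivity of the digraph of nonzero entries on \<open>I\<close>: the excluded
  \<open>S\<close> is a proper nonempty set of vertices that no edge leaves.\<close>

definition irred_on :: "(nat \<Rightarrow> nat \<Rightarrow> complex) \<Rightarrow> nat set \<Rightarrow> bool" where
  "irred_on a I \<longleftrightarrow> \<not> (\<exists>S. S \<noteq> {} \<and> S \<subset> I \<and> (\<forall>i\<in>S. \<forall>j\<in>I - S. a i j = 0))"

text \<open>Scaling the strictly lower entries by \<open>c\<close> turns \<open>A\<close> into
  \<open>D_A - U_A - c L_A\<close>, the pencil behind the eigenvalue equation of the iteration
  matrix.\<close>

definition lower_twist :: "complex \<Rightarrow> nat \<Rightarrow> nat \<Rightarrow> complex" where
  "lower_twist c i j = (if j < i then c else 1)"

text \<open>
  These are the phases for which every row of the matrix twisted by \<open>cis (- \<phi>)\<close>, applied to the vector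
  with entries \<open>\<alpha> j * z j\<close>, collapses, up to a common factor,
  to the difference of the two sides in \<^const>\<open>equi_on\<close>.
\<close>

definition aligned_on :: "(nat \<Rightarrow> nat \<Rightarrow> complex) \<Rightarrow> real \<Rightarrow> nat set \<Rightarrow> bool" where
  "aligned_on a \<phi> I \<longleftrightarrow> (\<exists>z. (\<forall>i\<in>I. cmod (z i) = 1) \<and>
     (\<forall>i\<in>I. \<forall>j\<in>I. i \<noteq> j \<longrightarrow>
        a i j / a i i = - of_real (cmod (a i j / a i i)) * z i * cnj (z j) * lower_twist (cis \<phi>) i j))"

section \<open>Equality case of the Gershgorin argument\<close>

text \<open>Equality in the triangle inequality: if the sum is nonzero with direction
  \<open>u\<close>, the real parts of the terms rotated by \<open>cnj u\<close> add up to the sum of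
  the moduli while none exceeds its modulus, so each rotated term is real and nonnegative.\<close>

lemma norm_sum_eq_imp_aligned:
  fixes f :: "'a \<Rightarrow> complex"
  assumes "finite J" "cmod (sum f J) = (\<Sum>j\<in>J. cmod (f j))" "j \<in> J"
  shows "f j = of_real (cmod (f j)) * sgn (sum f J)"
proof (cases "sum f J = 0")
  case True
  then have "\<forall>j\<in>J. cmod (f j) = 0"
    using assms(1,2) by (simp add: sum_nonneg_eq_0_iff)
  then show ?thesis using assms(3) by simp
next
  case False
  define u where "u = sgn (sum f J)"
  have u: "cmod u = 1" "cnj u * u = 1" "u * cnj u = 1"
    using False by (auto simp: u_def norm_sgn complex_norm_square[symmetric] mult.commute)
  have S: "sum f J = of_real (cmod (sum f J)) * u"
    using False by (simp add: u_def sgn_eq)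
  have le: "Re (cnj u * f i) \<le> cmod (f i)" for i
    using complex_Re_le_cmod[of "cnj u * f i"] u(1) by (simp add: norm_mult)
  have "(\<Sum>i\<in>J. Re (cnj u * f i)) = Re (cnj u * sum f J)"
    by (simp add: sum_distrib_left)
  also have "cnj u * sum f J = of_real (cmod (sum f J))"
    by (subst S) (use u(2) in \<open>simp add: mult.assoc mult.left_commute\<close>)
  finally have eq: "(\<Sum>i\<in>J. Re (cnj u * f i)) = (\<Sum>i\<in>J. cmod (f i))"
    using assms(2) by simp
  have R: "Re (cnj u * f j) = cmod (f j)"
    by (rule sum_mono_inv[OF eq le assms(3,1)])
  then have "Re (cnj u * f j) = cmod (cnj u * f j)" using u(1) by (simp add: norm_mult)
  then have "cnj u * f j = of_real (cmod (f j))"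
    using R by (metis complex_is_Real_iff complex_eqI Im_complex_of_real Re_complex_of_real cmod_eq_Re cmod_power2 add_cancel_right_right power2_eq_iff zero_eq_power2)
  then have "u * (cnj u * f j) = u * of_real (cmod (f j))" by simp
  then show ?thesis using u(3) by (simp add: u_def[symmetric] mult.assoc[symmetric] mult.commute)
qed

text \<open>In this lemma \<open>\<mu>\<close> stands for the reciprocal of the eigenvalue, hence
  the bound \<open>cmod \<mu> \<le> 1\<close>. The phase constructed satisfies
  \<open>cis \<phi> = cnj \<mu>\<close>, the inverse of \<open>\<mu>\<close>.\<close>

lemma twisted_kernel_imp_aligned_component:
  fixes a :: "nat \<Rightarrow> nat \<Rightarrow> complex"
  assumes nz: "\<And>i. i < n \<Longrightarrow> a i i \<noteq> 0"
    and pos: "\<And>i. i < n \<Longrightarrow> \<alpha> i > 0"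
    and dom: "dominant_on a \<alpha> {..<n}"
    and mu: "cmod \<mu> \<le> 1"
    and v0: "k < n" "v k \<noteq> 0"
    and ker: "\<And>i. i < n \<Longrightarrow> (\<Sum>j<n. lower_twist \<mu> i j * a i j * v j) = 0"
  obtains I \<phi> where "I \<subseteq> {..<n}" "2 \<le> card I" "irred_on a I" "equi_on a \<alpha> I" "aligned_on a \<phi> I"
proof -
  \<comment> \<open>Scaling the columns by \<open>\<alpha>\<close> reduces weighted dominance to
    ordinary dominance; \<open>w\<close> is the modulus of \<open>v\<close> in the scaled
    coordinates.\<close>
  define w where "w j = cmod (v j) / \<alpha> j" for j
  have w: "cmod (v j) = \<alpha> j * w j" if "j < n" for j
    using pos[OF that] by (simp add: w_def)
  have w_nonneg: "0 \<le> w j" if "j < n" for j using pos[OF that] by (simp add: w_def)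
  define mx where "mx = Max (w ` {..<n})"
  have fin: "finite (w ` {..<n})" "w ` {..<n} \<noteq> {}" using v0 by auto
  have mx: "w j \<le> mx" if "j < n" for j using that fin by (auto simp: mx_def)
  have "0 < w k" using v0 pos by (simp add: w_def)
  then have mx_pos: "0 < mx" using mx[OF v0(1)] by simp
  define K where "K = {i. i < n \<and> w i = mx}"
  have K_ne: "K \<noteq> {}"
    using Max_in[OF fin] unfolding K_def mx_def by auto
  define m where "m i j = lower_twist \<mu> i j * a i j" for i j
  have m_le: "cmod (m i j) \<le> cmod (a i j)" for i j
    using mu by (auto simp: m_def lower_twist_def norm_mult mult_left_le_one_le)
  have row: "(\<Sum>j\<in>{..<n} - {i}. \<alpha> j * cmod (a i j)) = \<alpha> i * cmod (a i i) \<and>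
     (\<forall>j\<in>{..<n} - {i}. cmod (m i j * v j) = mx * (\<alpha> j * cmod (a i j)) \<and>
        m i j * v j = - of_real (cmod (m i j * v j)) * sgn (a i i * v i))" if i: "i \<in> K" for i
  proof -
    let ?J = "{..<n} - {i}"
    have i': "i < n" "w i = mx" using i by (auto simp: K_def)
    have "(\<Sum>j<n. m i j * v j) = a i i * v i + (\<Sum>j\<in>?J. m i j * v j)"
      using i' by (subst sum.remove[of _ i]) (auto simp: m_def lower_twist_def)
    then have S: "(\<Sum>j\<in>?J. m i j * v j) = - (a i i * v i)"
      using ker[OF i'(1)] by (simp add: m_def add_eq_0_iff)
    have t1: "cmod (\<Sum>j\<in>?J. m i j * v j) = mx * (\<alpha> i * cmod (a i i))"
      unfolding S using i' by (simp add: norm_mult w)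
    have t2: "cmod (\<Sum>j\<in>?J. m i j * v j) \<le> (\<Sum>j\<in>?J. cmod (m i j * v j))"
      by (rule norm_sum)
    have le: "cmod (m i j * v j) \<le> mx * (\<alpha> j * cmod (a i j))" if "j \<in> ?J" for j
    proof -
      have j: "j < n" using that by simp
      have "cmod (m i j) * (\<alpha> j * w j) \<le> cmod (a i j) * (\<alpha> j * mx)"
        using pos[OF j] w_nonneg[OF j] mx[OF j] by (intro mult_mono m_le mult_nonneg_nonneg) auto
      then show ?thesis by (simp add: norm_mult w[OF j] mult_ac)
    qed
    have t3: "(\<Sum>j\<in>?J. cmod (m i j * v j)) \<le> (\<Sum>j\<in>?J. mx * (\<alpha> j * cmod (a i j)))"
      by (rule sum_mono) (rule le)
    have t4: "(\<Sum>j\<in>?J. mx * (\<alpha> j * cmod (a i j))) \<le> mx * (\<alpha> i * cmod (a i i))"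
      using dom i' mx_pos by (simp add: dominant_on_def sum_distrib_left[symmetric])
    \<comment> \<open>The relations \<open>t1\<close> to \<open>t4\<close> lead from
      \<open>mx * (\<alpha> i * cmod (a i i))\<close> back to itself, so every inequality in the
      chain is an equality.\<close>
    have e1: "cmod (\<Sum>j\<in>?J. m i j * v j) = (\<Sum>j\<in>?J. cmod (m i j * v j))"
      and e2: "(\<Sum>j\<in>?J. cmod (m i j * v j)) = (\<Sum>j\<in>?J. mx * (\<alpha> j * cmod (a i j)))"
      and e3: "(\<Sum>j\<in>?J. mx * (\<alpha> j * cmod (a i j))) = mx * (\<alpha> i * cmod (a i i))"
      using t1 t2 t3 t4 by linarith+
    have "mx * (\<Sum>j\<in>?J. \<alpha> j * cmod (a i j)) = mx * (\<alpha> i * cmod (a i i))"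
      using e3 by (simp add: sum_distrib_left)
    then have "(\<Sum>j\<in>?J. \<alpha> j * cmod (a i j)) = \<alpha> i * cmod (a i i)"
      using mx_pos by simp
    moreover have "cmod (m i j * v j) = mx * (\<alpha> j * cmod (a i j))" if "j \<in> ?J" for j
      by (rule sum_mono_inv[OF e2 le that]) auto
    moreover have "m i j * v j = - of_real (cmod (m i j * v j)) * sgn (a i i * v i)" if "j \<in> ?J" for j
      using norm_sum_eq_imp_aligned[OF _ e1 that] unfolding S by (simp add: sgn_minus)
    ultimately show ?thesis by blast
  qed
  \<comment> \<open>A nonzero entry in a row of \<open>K\<close> leaves no slack: its column attains
    the maximum as well, and the twist has not reduced its modulus.\<close>
  have nbr: "j \<in> K \<and> cmod (m i j) = cmod (a i j)" if i: "i \<in> K" and j: "j < n" "j \<noteq> i" and a: "a i j \<noteq> 0" for i j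
  proof -
    have "cmod (m i j * v j) = mx * (\<alpha> j * cmod (a i j))" using row[OF i] j by simp
    then have e: "cmod (m i j) * w j = cmod (a i j) * mx"
      using pos[OF j(1)] by (simp add: norm_mult w[OF j(1)])
    have "w j = mx"
    proof (rule ccontr)
      assume "w j \<noteq> mx"
      then have "w j < mx" using mx[OF j(1)] by simp
      then have "cmod (m i j) * w j < cmod (a i j) * mx"
        using a w_nonneg[OF j(1)] m_le[of i j]
        by (meson le_less_trans mult_right_mono mult_strict_left_mono zero_less_norm_iff)
      then show False using e by simp
    qed
    then show ?thesis using e mx_pos j by (auto simp: K_def)
  qed
  (* An inclusion-minimal closed subset of K is an irreducible component. *)
  define closed where "closed S \<longleftrightarrow> S \<noteq> {} \<and> S \<subseteq> K \<and> (\<forall>i\<in>S. \<forall>j\<in>{..<n} - S. a i j = 0)" for S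
  have "closed K" using K_ne nbr unfolding closed_def by (auto simp: K_def)
  from ex_has_least_nat[of closed, OF this, of card] obtain I
    where I: "closed I" and I_min: "\<And>S. closed S \<Longrightarrow> card I \<le> card S" by blast
  have I_K: "I \<subseteq> K" and I_ne: "I \<noteq> {}" and I_cl: "\<And>i j. i \<in> I \<Longrightarrow> j < n \<Longrightarrow> j \<notin> I \<Longrightarrow> a i j = 0"
    using I by (auto simp: closed_def)
  have I_n: "I \<subseteq> {..<n}" using I_K by (auto simp: K_def)
  then have finI: "finite I" using finite_subset by auto
  have irr: "irred_on a I"
    unfolding irred_on_def
  proof (intro notI, elim exE conjE)
    fix S assume S: "S \<noteq> {}" "S \<subset> I" "\<forall>i\<in>S. \<forall>j\<in>I - S. a i j = 0"
    have "closed S" using S I_K I_cl unfolding closed_def by blast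
    then show False using I_min psubset_card_mono[OF finI S(2)] by fastforce
  qed
  have equi: "equi_on a \<alpha> I"
    unfolding equi_on_def
  proof
    fix i assume i: "i \<in> I"
    have "(\<Sum>j\<in>{..<n} - {i}. \<alpha> j * cmod (a i j)) = (\<Sum>j\<in>I - {i}. \<alpha> j * cmod (a i j))"
      using I_n I_cl[OF i] by (intro sum.mono_neutral_right) auto
    then show "\<alpha> i * cmod (a i i) = (\<Sum>j\<in>I - {i}. \<alpha> j * cmod (a i j))"
      using row[of i] i I_K by auto
  qed
  \<comment> \<open>In the row of the largest index every other column of \<open>I\<close> lies in
    the strictly lower part, and equipotency supplies a nonzero entry there. It is multiplied by
    \<open>\<mu>\<close> without loss of modulus, which forces
    \<open>cmod \<mu> = 1\<close>.\<close>
  define t where "t = Max I"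
  have t: "t \<in> I" "\<And>i. i \<in> I \<Longrightarrow> i \<le> t" using finI I_ne by (auto simp: t_def)
  have "0 < \<alpha> t * cmod (a t t)" using t I_n nz pos by auto
  then have "(\<Sum>j\<in>I - {t}. \<alpha> j * cmod (a t j)) \<noteq> 0" using equi t by (auto simp: equi_on_def)
  then obtain j where j: "j \<in> I" "j \<noteq> t" "a t j \<noteq> 0"
    by (metis (no_types, lifting) DiffE insertCI mult_zero_right norm_zero sum.neutral)
  have jt: "j < t" using j t by (simp add: le_neq_implies_less)
  have "cmod (m t j) = cmod (a t j)" using nbr[of t j] j t I_K I_n by blast
  then have mu1: "cmod \<mu> = 1" using jt j by (simp add: m_def lower_twist_def norm_mult)
  have card: "2 \<le> card I"
    using card_mono[OF finI, of "{j,t}"] j t by simp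
  \<comment> \<open>Since \<open>cmod \<mu> = 1\<close>, conjugation inverts \<open>\<mu>\<close>,
    and twisting by \<open>cis \<phi>\<close> undoes the twist by \<open>\<mu>\<close>.\<close>
  define \<phi> where "\<phi> = Arg (cnj \<mu>)"
  have phi: "cis \<phi> = cnj \<mu>"
    using mu1 cis_Arg[of "cnj \<mu>"] unfolding \<phi>_def by (cases "\<mu> = 0") (auto simp: sgn_eq)
  \<comment> \<open>The witnesses are the phases of the null vector, which has no zero entry on
    \<open>I\<close> because \<open>w\<close> equals the positive number \<open>mx\<close>
    there.\<close>
  define z where "z i = sgn (v i)" for i
  have v_ne: "v i \<noteq> 0" if "i \<in> I" for i
    using that I_K mx_pos by (auto simp: K_def w_def)
  have z1: "cmod (z i) = 1" "z i * cnj (z i) = 1" if "i \<in> I" for i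
    using v_ne[OF that] by (auto simp: z_def norm_sgn complex_norm_square[symmetric])
  have "aligned_on a \<phi> I"
    unfolding aligned_on_def
  proof (intro exI[of _ z] conjI ballI impI)
    fix i j assume ij: "i \<in> I" "j \<in> I" "i \<noteq> j"
    let ?c = "lower_twist \<mu> i j"
    show "a i j / a i i = - of_real (cmod (a i j / a i i)) * z i * cnj (z j) * lower_twist (cis \<phi>) i j"
    proof (cases "a i j = 0")
      case False
      have aii: "a i i \<noteq> 0" using ij I_n nz by auto
      have cm: "cmod (m i j) = cmod (a i j)" using nbr[of i j] ij False I_K I_n by auto
      have "m i j * v j = - of_real (cmod (m i j * v j)) * sgn (a i i * v i)"
        using row[of i] ij I_K I_n by auto
      then have "m i j * (of_real (cmod (v j)) * z j) =
          - of_real (cmod (a i j)) * of_real (cmod (v j)) * (sgn (a i i) * z i)"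
        using v_ne[OF ij(2)] by (simp add: norm_mult cm sgn_mult z_def sgn_eq)
      then have "of_real (cmod (v j)) * (m i j * z j) =
          of_real (cmod (v j)) * (- of_real (cmod (a i j)) * (sgn (a i i) * z i))"
        by (simp add: mult_ac)
      then have "m i j * z j = - of_real (cmod (a i j)) * (sgn (a i i) * z i)"
        using v_ne[OF ij(2)] by (simp only: mult_cancel_left of_real_eq_0_iff norm_eq_zero simp_thms)
      then have "m i j * (z j * cnj (z j)) = - of_real (cmod (a i j)) * sgn (a i i) * z i * cnj (z j)"
        by (simp add: mult.assoc[symmetric])
      then have "m i j = - of_real (cmod (a i j)) * sgn (a i i) * z i * cnj (z j)"
        using z1[OF ij(2)] by simp
      then have "?c * (a i j / a i i) = - of_real (cmod (a i j / a i i)) * z i * cnj (z j)"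
        using aii by (simp add: m_def norm_divide sgn_eq field_simps)
      then have "lower_twist (cis \<phi>) i j * (?c * (a i j / a i i)) =
          - of_real (cmod (a i j / a i i)) * z i * cnj (z j) * lower_twist (cis \<phi>) i j"
        by simp
      moreover have "lower_twist (cis \<phi>) i j * ?c = 1"
        using mu1 by (simp add: lower_twist_def phi mult.commute complex_norm_square[symmetric])
      ultimately show ?thesis by (simp add: mult.assoc[symmetric])
    qed simp
  qed (use z1 in auto)
  then show ?thesis using that I_n card irr equi by blast
qed

section \<open>Singularity of the twisted matrix from an aligned component\<close>

text \<open>Twists and phases cancel, leaving each off-diagonal term as the common factor
  \<open>- (a i i / cmod (a i i)) * z i\<close> times the real number
  \<open>\<beta> j * cmod (a i j)\<close>; by equipotency these add up to the negative of the
  diagonal term.\<close>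

lemma sum_twisted_row:
  assumes fin: "finite I" and i: "i \<in> I" and aii: "a i i \<noteq> 0"
    and equi: "\<beta> i * cmod (a i i) = (\<Sum>j\<in>I - {i}. \<beta> j * cmod (a i j))"
    and z1: "\<And>j. j \<in> I \<Longrightarrow> cmod (z j) = 1"
    and al: "\<And>j. j \<in> I \<Longrightarrow> i \<noteq> j \<Longrightarrow> a i j / a i i =
        - of_real (cmod (a i j / a i i)) * z i * cnj (z j) * lower_twist (cis \<phi>) i j"
  shows "(\<Sum>j\<in>I. lower_twist (cis (- \<phi>)) i j * a i j * (of_real (\<beta> j) * z j)) = 0"
proof -
  have t: "lower_twist (cis (- \<phi>)) i j * a i j * (of_real (\<beta> j) * z j) =
      - (a i i / of_real (cmod (a i i)) * z i) * of_real (\<beta> j * cmod (a i j))" if j: "j \<in> I - {i}" for j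
  proof -
    have tw: "lower_twist (cis (- \<phi>)) i j * lower_twist (cis \<phi>) i j = 1"
      by (simp add: lower_twist_def cis_mult)
    have zz: "cnj (z j) * z j = 1"
      using z1[of j] j by (simp add: mult.commute complex_norm_square[symmetric])
    have "a i j = a i i * (a i j / a i i)" using aii by simp
    also have "a i j / a i i = - of_real (cmod (a i j / a i i)) * z i * cnj (z j) * lower_twist (cis \<phi>) i j"
      using al j by auto
    finally have e: "a i j = a i i * (- of_real (cmod (a i j / a i i)) * z i * cnj (z j) * lower_twist (cis \<phi>) i j)" .
    have "lower_twist (cis (- \<phi>)) i j * a i j * (of_real (\<beta> j) * z j) =
       - a i i * of_real (cmod (a i j / a i i)) * z i * (cnj (z j) * z j) * of_real (\<beta> j) *
         (lower_twist (cis (- \<phi>)) i j * lower_twist (cis \<phi>) i j)"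
      by (subst e) (simp add: mult_ac)
    also have "\<dots> = - (a i i / of_real (cmod (a i i)) * z i) * of_real (\<beta> j * cmod (a i j))"
      unfolding tw zz by (simp add: norm_divide mult_ac)
    finally show ?thesis .
  qed
  have "(\<Sum>j\<in>I - {i}. lower_twist (cis (- \<phi>)) i j * a i j * (of_real (\<beta> j) * z j)) =
      - (a i i / of_real (cmod (a i i)) * z i) * of_real (\<Sum>j\<in>I - {i}. \<beta> j * cmod (a i j))"
    by (simp add: t sum_distrib_left)
  also have "\<dots> = - (a i i * (of_real (\<beta> i) * z i))"
    unfolding equi[symmetric] using aii by simp
  finally show ?thesis
    using fin i by (subst sum.remove[of I i]) (auto simp: lower_twist_def)
qed

text \<open>
  Irreducibility forces \<open>\<beta>\<close> to be proportional to \<open>\<alpha>\<close> on \<open>I\<close> (look where \<open>\<beta> / \<alpha>\<close> is maximal), and then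
  the dominance inequality leaves no room for entries outside \<open>I\<close>.
\<close>

lemma equi_component_closed:
  fixes a :: "nat \<Rightarrow> nat \<Rightarrow> complex"
  assumes pos: "\<And>i. i < n \<Longrightarrow> \<alpha> i > 0"
    and dom: "dominant_on a \<alpha> {..<n}"
    and I: "I \<subseteq> {..<n}" "I \<noteq> {}" "irred_on a I"
    and equi: "equi_on a \<beta> I" and bpos: "\<And>i. i \<in> I \<Longrightarrow> \<beta> i > 0"
    and k: "k \<in> I" "l < n" "l \<notin> I"
  shows "a k l = 0"
proof -
  have finI: "finite I" using I finite_subset by auto
  define w where "w i = \<beta> i / \<alpha> i" for i
  \<comment> \<open>The least constant with \<open>\<beta> \<le> \<gamma> * \<alpha>\<close> on
    \<open>I\<close>; it is attained at \<open>i0\<close>, and \<open>S\<close> below collects all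
    indices where it is attained.\<close>
  define \<gamma> where "\<gamma> = Max (w ` I)"
  have apos: "\<alpha> i > 0" if "i \<in> I" for i using that I pos by auto
  have fin: "finite (w ` I)" "w ` I \<noteq> {}" using I finI by auto
  have b_le: "\<beta> i \<le> \<gamma> * \<alpha> i" if "i \<in> I" for i
  proof -
    have "w i \<le> \<gamma>" using that fin by (auto simp: \<gamma>_def)
    then show ?thesis using apos[OF that] by (simp add: w_def field_simps)
  qed
  obtain i0 where i0: "i0 \<in> I" "w i0 = \<gamma>" using Max_in[OF fin] unfolding \<gamma>_def by auto
  have g_pos: "\<gamma> > 0" using i0 bpos apos by (auto simp: w_def)
  define S where "S = {i \<in> I. \<beta> i = \<gamma> * \<alpha> i}"
  have i0S: "i0 \<in> S" using i0 apos[OF i0(1)] by (auto simp: S_def w_def field_simps)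
  have row: "(\<forall>j\<in>I - {i}. \<beta> j * cmod (a i j) = \<gamma> * \<alpha> j * cmod (a i j)) \<and>
      (\<forall>j\<in>{..<n} - I. a i j = 0)" if i: "i \<in> S" for i
  proof -
    have i': "i \<in> I" "\<beta> i = \<gamma> * \<alpha> i" "i < n" using i I by (auto simp: S_def)
    have le: "\<beta> j * cmod (a i j) \<le> \<gamma> * \<alpha> j * cmod (a i j)" if "j \<in> I - {i}" for j
      using b_le that by (intro mult_right_mono) auto
    have s1: "(\<Sum>j\<in>I - {i}. \<beta> j * cmod (a i j)) \<le> (\<Sum>j\<in>I - {i}. \<gamma> * \<alpha> j * cmod (a i j))"
      by (rule sum_mono) (rule le)
    have split: "(\<Sum>j\<in>{..<n} - {i}. \<gamma> * \<alpha> j * cmod (a i j)) =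
        (\<Sum>j\<in>I - {i}. \<gamma> * \<alpha> j * cmod (a i j)) + (\<Sum>j\<in>{..<n} - I. \<gamma> * \<alpha> j * cmod (a i j))"
    proof -
      have "{..<n} - {i} = (I - {i}) \<union> ({..<n} - I)" using I(1) i'(1) by auto
      moreover have "(I - {i}) \<inter> ({..<n} - I) = {}" by auto
      ultimately show ?thesis
        using sum.union_disjoint[of "I - {i}" "{..<n} - I" "\<lambda>j. \<gamma> * \<alpha> j * cmod (a i j)"] finI
        by (simp only: finite_Diff finite_lessThan)
    qed
    have nn: "0 \<le> \<gamma> * \<alpha> j * cmod (a i j)" if "j \<in> {..<n} - I" for j
      using g_pos pos[of j] that by simp
    have s2: "0 \<le> (\<Sum>j\<in>{..<n} - I. \<gamma> * \<alpha> j * cmod (a i j))"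
      by (rule sum_nonneg) (rule nn)
    have "\<gamma> * (\<Sum>j\<in>{..<n} - {i}. \<alpha> j * cmod (a i j)) \<le> \<gamma> * (\<alpha> i * cmod (a i i))"
      using dom i' g_pos by (simp add: dominant_on_def)
    then have s3: "(\<Sum>j\<in>{..<n} - {i}. \<gamma> * \<alpha> j * cmod (a i j)) \<le> \<beta> i * cmod (a i i)"
      using i' by (simp add: sum_distrib_left mult_ac)
    have s4: "\<beta> i * cmod (a i i) = (\<Sum>j\<in>I - {i}. \<beta> j * cmod (a i j))"
      using equi[unfolded equi_on_def] i'(1) by (rule bspec)
    \<comment> \<open>Equipotency, the bound by \<open>\<gamma> * \<alpha>\<close>, nonnegativity of
      the terms outside \<open>I\<close> and dominance of row \<open>i\<close> scaled by
      \<open>\<gamma>\<close> lead from \<open>\<beta> i * cmod (a i i)\<close> back to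
      itself.\<close>
    have e1: "(\<Sum>j\<in>I - {i}. \<beta> j * cmod (a i j)) = (\<Sum>j\<in>I - {i}. \<gamma> * \<alpha> j * cmod (a i j))"
      and e2: "(\<Sum>j\<in>{..<n} - I. \<gamma> * \<alpha> j * cmod (a i j)) = 0"
      using s1 s2 s3 s4 split by linarith+
    have "\<beta> j * cmod (a i j) = \<gamma> * \<alpha> j * cmod (a i j)" if "j \<in> I - {i}" for j
      by (rule sum_mono_inv[OF e1 le that]) (use finI in auto)
    moreover have "a i j = 0" if j: "j \<in> {..<n} - I" for j
    proof -
      have "\<gamma> * \<alpha> j * cmod (a i j) = 0"
        using sum_nonneg_eq_0_iff[of "{..<n} - I" "\<lambda>j. \<gamma> * \<alpha> j * cmod (a i j)"] nn e2 j by auto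
      then show ?thesis using g_pos pos[of j] j by auto
    qed
    ultimately show ?thesis by blast
  qed
  \<comment> \<open>Off \<open>S\<close> the bound on \<open>\<beta>\<close> is strict, so the
    termwise equality can hold only for a zero entry; irreducibility then makes \<open>S\<close> all
    of \<open>I\<close>.\<close>
  have "\<forall>i\<in>S. \<forall>j\<in>I - S. a i j = 0"
  proof (intro ballI)
    fix i j assume ij: "i \<in> S" "j \<in> I - S"
    then have "\<beta> j * cmod (a i j) = \<gamma> * \<alpha> j * cmod (a i j)" using row[of i] by blast
    moreover have "\<beta> j \<noteq> \<gamma> * \<alpha> j" using ij by (auto simp: S_def)
    ultimately show "a i j = 0" by simp
  qed
  moreover have "S \<noteq> {}" using i0S by auto
  moreover have "S \<subseteq> I" by (simp add: S_def)
  ultimately have "S = I" using I(3) unfolding irred_on_def by (metis psubsetI)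
  then show ?thesis using row[of k] k by simp
qed

text \<open>The vector \<open>y\<close> built from weights and phases is annihilated by the rows in
  \<open>I\<close>, but the other rows may meet the columns of \<open>I\<close>. The argument
  therefore turns to left null vectors, which closedness of \<open>I\<close> confines to
  \<open>I\<close>.\<close>

lemma aligned_component_imp_twisted_singular:
  fixes a :: "nat \<Rightarrow> nat \<Rightarrow> complex"
  assumes nz: "\<And>i. i < n \<Longrightarrow> a i i \<noteq> 0"
    and I: "I \<subseteq> {..<n}" "I \<noteq> {}"
    and closed: "\<And>i j. i \<in> I \<Longrightarrow> j < n \<Longrightarrow> j \<notin> I \<Longrightarrow> a i j = 0"
    and equi: "equi_on a \<beta> I" and bpos: "\<And>i. i \<in> I \<Longrightarrow> \<beta> i > 0"
    and al: "aligned_on a \<phi> I"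
  shows "det (mat n n (\<lambda>(i,j). lower_twist (cis (- \<phi>)) i j * a i j)) = 0"
proof -
  have finI: "finite I" using I finite_subset by auto
  define m where "m i j = lower_twist (cis (- \<phi>)) i j * a i j" for i j
  obtain z where z1: "\<And>i. i \<in> I \<Longrightarrow> cmod (z i) = 1" and
    z: "\<And>i j. i \<in> I \<Longrightarrow> j \<in> I \<Longrightarrow> i \<noteq> j \<Longrightarrow> a i j / a i i =
      - of_real (cmod (a i j / a i i)) * z i * cnj (z j) * lower_twist (cis \<phi>) i j"
    using al unfolding aligned_on_def by blast
  define y where "y = vec n (\<lambda>j. if j \<in> I then of_real (\<beta> j) * z j else 0)"
  (* With the rows outside I replaced by unit rows, every left null vector is supported on I,
     hence is a left null vector of the full matrix. *)
  define M' where "M' = mat n n (\<lambda>(i,j). if i \<in> I then m i j else if i = j then 1 else (0::complex))"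
  have M': "M' \<in> carrier_mat n n" by (simp add: M'_def)
  have ker: "(\<Sum>j\<in>I. m i j * (of_real (\<beta> j) * z j)) = 0" if i: "i \<in> I" for i
    unfolding m_def
    by (rule sum_twisted_row[where a = a]) (use i finI nz I z1 z equi in \<open>auto simp: equi_on_def\<close>)
  have "M' *\<^sub>v y = 0\<^sub>v n"
  proof (rule eq_vecI)
    fix i assume "i < dim_vec (0\<^sub>v n :: complex vec)"
    then have i: "i < n" by simp
    have "(M' *\<^sub>v y) $ i = (\<Sum>j<n. M' $$ (i,j) * y $ j)"
      using i by (simp add: M'_def y_def scalar_prod_def atLeast0LessThan)
    also have "\<dots> = (\<Sum>j\<in>I. M' $$ (i,j) * y $ j)"
      using I by (intro sum.mono_neutral_right) (auto simp: y_def)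
    also have "\<dots> = (if i \<in> I then (\<Sum>j\<in>I. m i j * (of_real (\<beta> j) * z j)) else 0)"
      using I i by (auto simp: M'_def y_def intro!: sum.cong sum.neutral)
    also have "\<dots> = 0" using ker by simp
    finally show "(M' *\<^sub>v y) $ i = 0\<^sub>v n $ i" using i by simp
  qed (simp add: M'_def)
  moreover have "y \<noteq> 0\<^sub>v n"
  proof -
    obtain i where i: "i \<in> I" using I by auto
    then have "y $ i \<noteq> 0" using I bpos[OF i] z1[OF i] by (auto simp: y_def)
    then show ?thesis using i I by auto
  qed
  ultimately have "det M' = 0"
    using det_0_iff_vec_prod_zero[OF M'] vec_carrier y_def by blast
  then have "det M'\<^sup>T = 0" using det_transpose[OF M'] by simp
  then obtain u where u: "u \<in> carrier_vec n" "u \<noteq> 0\<^sub>v n" "M'\<^sup>T *\<^sub>v u = 0\<^sub>v n"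
    using det_0_iff_vec_prod_zero[of "M'\<^sup>T" n] M' by auto
  have col: "(\<Sum>i<n. M' $$ (i,j) * u $ i) = 0" if j: "j < n" for j
  proof -
    have "(M'\<^sup>T *\<^sub>v u) $ j = (\<Sum>i<n. M' $$ (i,j) * u $ i)"
      using j u(1) M' by (simp add: scalar_prod_def atLeast0LessThan)
    then show ?thesis using u(3) j by simp
  qed
  \<comment> \<open>The rows of \<open>I\<close> vanish in a column \<open>j\<close> outside
    \<open>I\<close>, so this column of \<open>M'\<close> is a unit vector and the column equation
    reads \<open>u $ j = 0\<close>.\<close>
  have u0: "u $ j = 0" if j: "j < n" "j \<notin> I" for j
  proof -
    have "(\<Sum>i<n. M' $$ (i,j) * u $ i) = (\<Sum>i\<in>{j}. M' $$ (i,j) * u $ i)"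
      using j closed by (intro sum.mono_neutral_right) (auto simp: M'_def m_def)
    then show ?thesis using col[OF j(1)] j by (simp add: M'_def)
  qed
  let ?M = "mat n n (\<lambda>(i,j). m i j)"
  have "?M\<^sup>T *\<^sub>v u = 0\<^sub>v n"
  proof (rule eq_vecI)
    fix j assume "j < dim_vec (0\<^sub>v n :: complex vec)"
    then have j: "j < n" by simp
    have "(?M\<^sup>T *\<^sub>v u) $ j = (\<Sum>i<n. m i j * u $ i)"
      using j u(1) by (simp add: scalar_prod_def atLeast0LessThan)
    also have "\<dots> = (\<Sum>i<n. M' $$ (i,j) * u $ i)"
      using j u0 by (intro sum.cong) (auto simp: M'_def)
    finally show "(?M\<^sup>T *\<^sub>v u) $ j = 0\<^sub>v n $ j" using col[OF j] j by simp
  qed simp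
  then have "det ?M\<^sup>T = 0" using u det_0_iff_vec_prod_zero[of "?M\<^sup>T" n] by auto
  then show ?thesis using det_transpose[of ?M n] by (simp add: m_def)
qed

text \<open>Two off-diagonal phases \<open>s\<close> and \<open>t\<close> face two free parameters:
  the relative phase of the witness absorbs \<open>s\<close>, and then \<open>cis \<phi>\<close> is
  chosen as \<open>s * t\<close> to match the entry below the diagonal.\<close>

lemma equi_on_pair_imp_aligned:
  assumes card: "card I = 2" and nz: "\<And>i. i \<in> I \<Longrightarrow> a i i \<noteq> 0"
    and equi: "equi_on a \<beta> I" and bpos: "\<And>i. i \<in> I \<Longrightarrow> \<beta> i > 0"
  obtains \<phi> where "aligned_on a \<phi> I"
proof -
  obtain i j where ij: "I = {i,j}" "i < j"
    using card by (metis card_2_iff doubleton_eq_iff linorder_neqE_nat)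
  have d: "{i,j} - {i} = {j}" "{i,j} - {j} = {i}" using ij(2) by auto
  have "\<beta> i * cmod (a i i) = \<beta> j * cmod (a i j)" "\<beta> j * cmod (a j j) = \<beta> i * cmod (a j i)"
    using equi ij by (auto simp: equi_on_def d)
  then have "a i j \<noteq> 0" "a j i \<noteq> 0" using bpos[of i] bpos[of j] nz[of i] nz[of j] ij by auto
  then have nz2: "a i j / a i i \<noteq> 0" "a j i / a j j \<noteq> 0" using nz ij by auto
  define s where "s = sgn (a i j / a i i)"
  define t where "t = sgn (a j i / a j j)"
  have s: "cmod s = 1" and t: "cmod t = 1" using nz2 unfolding s_def t_def norm_sgn by auto
  have ss: "s * cnj s = 1" using s by (simp add: complex_norm_square[symmetric])
  have e: "a i j / a i i = of_real (cmod (a i j / a i i)) * s"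
    "a j i / a j j = of_real (cmod (a j i / a j j)) * t"
    using nz2 by (simp_all add: s_def t_def sgn_eq)
  have "cmod (s * t) = 1" using s t by (simp add: norm_mult)
  then have phi: "cis (Arg (s * t)) = s * t"
    using cis_Arg[of "s * t"] by (cases "s * t = 0") (auto simp: sgn_eq)
  have "aligned_on a (Arg (s * t)) I"
    unfolding aligned_on_def
  proof (intro exI[of _ "\<lambda>k. if k = i then 1 else - cnj s"] conjI ballI impI)
    fix k l assume kl: "k \<in> I" "l \<in> I" "k \<noteq> l"
    then consider "k = i" "l = j" | "k = j" "l = i" using ij by auto
    then show "a k l / a k k = - of_real (cmod (a k l / a k k)) * (if k = i then 1 else - cnj s)
        * cnj (if l = i then 1 else - cnj s) * lower_twist (cis (Arg (s * t))) k l"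
    proof cases
      case 1
      then show ?thesis using e(1) ij(2) by (simp add: lower_twist_def)
    next
      case 2
      have "- of_real (cmod (a j i / a j j)) * (- cnj s) * cnj 1 * (s * t) =
          of_real (cmod (a j i / a j j)) * t * (s * cnj s)" by simp
      then show ?thesis using 2 e(2) ij(2) ss by (simp add: lower_twist_def phi)
    qed
  qed (use s ij in auto)
  then show ?thesis using that by blast
qed

section \<open>Invariance under renumbering and row scaling\<close>

lemma irred_on_reindex:
  assumes p: "bij_betw p K I"
  shows "irred_on (\<lambda>r s. a (p r) (p s)) K \<longleftrightarrow> irred_on a I"
proof -
  have inj: "inj_on p K" and im: "p ` K = I" using p by (auto simp: bij_betw_def)
  have "(\<exists>S. S \<noteq> {} \<and> S \<subset> K \<and> (\<forall>i\<in>S. \<forall>j\<in>K - S. a (p i) (p j) = 0)) \<longleftrightarrow>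
      (\<exists>T. T \<noteq> {} \<and> T \<subset> I \<and> (\<forall>i\<in>T. \<forall>j\<in>I - T. a i j = 0))" (is "?l = ?r")
  proof
    assume ?l
    then obtain S where S: "S \<noteq> {}" "S \<subset> K" "\<forall>i\<in>S. \<forall>j\<in>K - S. a (p i) (p j) = 0" by blast
    have diff: "I - p ` S = p ` (K - S)"
      using S inj im inj_on_image_set_diff[of p K K S] by auto
    have "p ` S \<subset> I"
      using image_strict_mono[of p K S] S inj im by simp
    then show ?r using S by (intro exI[of _ "p ` S"]) (auto simp: diff)
  next
    assume ?r
    then obtain T where T: "T \<noteq> {}" "T \<subset> I" "\<forall>i\<in>T. \<forall>j\<in>I - T. a i j = 0" by blast
    let ?S = "{r \<in> K. p r \<in> T}"
    have "?S \<noteq> {}" "?S \<subset> K" using T im by auto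
    then show ?l using T im by (intro exI[of _ ?S]) auto
  qed
  then show ?thesis by (simp add: irred_on_def)
qed

lemma equi_on_reindex:
  assumes p: "bij_betw p K I"
  shows "equi_on (\<lambda>r s. a (p r) (p s)) (\<alpha> \<circ> p) K \<longleftrightarrow> equi_on a \<alpha> I"
proof -
  have im: "I = p ` K" using p by (auto simp: bij_betw_def)
  have "(\<Sum>s\<in>K - {r}. \<alpha> (p s) * cmod (a (p r) (p s))) =
      (\<Sum>j\<in>I - {p r}. \<alpha> j * cmod (a (p r) j))" if "r \<in> K" for r
  proof (rule sum.reindex_bij_betw)
    show "bij_betw p (K - {r}) (I - {p r})"
      using p that unfolding bij_betw_def by (auto intro: inj_on_subset dest: inj_onD)
  qed
  then show ?thesis by (simp add: equi_on_def im)
qed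

lemma ex_equi_on_reindex:
  assumes p: "bij_betw p K I"
  shows "(\<exists>\<beta>. (\<forall>r\<in>K. \<beta> r > 0) \<and> equi_on (\<lambda>r s. a (p r) (p s)) \<beta> K) \<longleftrightarrow>
    (\<exists>\<beta>. (\<forall>i\<in>I. \<beta> i > 0) \<and> equi_on a \<beta> I)"
proof
  have im: "p ` K = I" and inv: "\<And>r. r \<in> K \<Longrightarrow> inv_into K p (p r) = r"
    using p by (auto simp: bij_betw_def)
  assume "\<exists>\<beta>. (\<forall>r\<in>K. \<beta> r > 0) \<and> equi_on (\<lambda>r s. a (p r) (p s)) \<beta> K"
  then obtain \<beta> where b: "\<forall>r\<in>K. \<beta> r > 0" "equi_on (\<lambda>r s. a (p r) (p s)) \<beta> K" by blast
  have "equi_on (\<lambda>r s. a (p r) (p s)) ((\<beta> \<circ> inv_into K p) \<circ> p) K"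
    using b(2) inv by (simp add: equi_on_def)
  then have "equi_on a (\<beta> \<circ> inv_into K p) I" using equi_on_reindex[OF p] by blast
  moreover have "\<forall>i\<in>I. (\<beta> \<circ> inv_into K p) i > 0" using b(1) inv im by auto
  ultimately show "\<exists>\<beta>. (\<forall>i\<in>I. \<beta> i > 0) \<and> equi_on a \<beta> I" by blast
next
  assume "\<exists>\<beta>. (\<forall>i\<in>I. \<beta> i > 0) \<and> equi_on a \<beta> I"
  then obtain \<beta> where b: "\<forall>i\<in>I. \<beta> i > 0" "equi_on a \<beta> I" by blast
  then show "\<exists>\<beta>. (\<forall>r\<in>K. \<beta> r > 0) \<and> equi_on (\<lambda>r s. a (p r) (p s)) \<beta> K"
    using equi_on_reindex[OF p, of a \<beta>] bij_betw_apply[OF p] by (intro exI[of _ "\<beta> \<circ> p"]) auto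
qed

text \<open>Unlike irreducibility and equipotency, alignment depends on the order of the indices
  through \<open>lower_twist\<close>, hence the strict monotonicity; the enumeration by
  \<open>pick\<close> has it.\<close>

lemma aligned_on_reindex:
  assumes p: "bij_betw p K I" and mono: "strict_mono_on K p"
  shows "aligned_on (\<lambda>r s. a (p r) (p s)) \<phi> K \<longleftrightarrow> aligned_on a \<phi> I"
proof -
  have im: "I = p ` K" and inj: "inj_on p K"
    and inv: "\<And>r. r \<in> K \<Longrightarrow> inv_into K p (p r) = r"
    using p by (auto simp: bij_betw_def)
  have tw: "lower_twist c (p r) (p s) = lower_twist c r s" if "r \<in> K" "s \<in> K" for c r s
    using strict_mono_on_less[OF mono that(2,1)] by (simp add: lower_twist_def)
  have ne: "p r = p s \<longleftrightarrow> r = s" if "r \<in> K" "s \<in> K" for r s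
    using inj that by (auto dest: inj_onD)
  show ?thesis
  proof
    assume "aligned_on (\<lambda>r s. a (p r) (p s)) \<phi> K"
    then obtain z where "\<forall>r\<in>K. cmod (z r) = 1"
      "\<forall>r\<in>K. \<forall>s\<in>K. r \<noteq> s \<longrightarrow> a (p r) (p s) / a (p r) (p r) =
        - of_real (cmod (a (p r) (p s) / a (p r) (p r))) * z r * cnj (z s) * lower_twist (cis \<phi>) r s"
      unfolding aligned_on_def by blast
    then show "aligned_on a \<phi> I"
      unfolding aligned_on_def im
      by (intro exI[of _ "z \<circ> inv_into K p"]) (simp add: inv tw ne)
  next
    assume "aligned_on a \<phi> I"
    then obtain z where "\<forall>r\<in>I. cmod (z r) = 1"
      "\<forall>r\<in>I. \<forall>s\<in>I. r \<noteq> s \<longrightarrow> a r s / a r r =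
        - of_real (cmod (a r s / a r r)) * z r * cnj (z s) * lower_twist (cis \<phi>) r s"
      unfolding aligned_on_def by blast
    then show "aligned_on (\<lambda>r s. a (p r) (p s)) \<phi> K"
      unfolding aligned_on_def im
      by (intro exI[of _ "z \<circ> p"]) (simp add: tw ne)
  qed
qed

lemma aligned_on_row_scale:
  assumes "\<And>i. i \<in> I \<Longrightarrow> a i i \<noteq> 0"
  shows "aligned_on (\<lambda>i j. a i j / a i i) \<phi> I \<longleftrightarrow> aligned_on a \<phi> I"
  using assms by (simp add: aligned_on_def)

lemma equi_on_row_scale:
  assumes "\<And>i. i \<in> I \<Longrightarrow> a i i \<noteq> 0"
  shows "equi_on (\<lambda>i j. a i j / a i i) \<alpha> I \<longleftrightarrow> equi_on a \<alpha> I"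
proof -
  have "\<alpha> i * cmod (a i i / a i i) = (\<Sum>j\<in>I - {i}. \<alpha> j * cmod (a i j / a i i)) \<longleftrightarrow>
      \<alpha> i * cmod (a i i) = (\<Sum>j\<in>I - {i}. \<alpha> j * cmod (a i j))" if "i \<in> I" for i
  proof -
    have sum: "(\<Sum>j\<in>I - {i}. \<alpha> j * cmod (a i j / a i i)) = (\<Sum>j\<in>I - {i}. \<alpha> j * cmod (a i j)) / cmod (a i i)"
      by (simp add: norm_divide sum_divide_distrib)
    show ?thesis unfolding sum using assms[OF that] by (simp add: eq_divide_eq)
  qed
  then show ?thesis by (simp add: equi_on_def)
qed

section \<open>Irreducibility and ray patterns of matrices\<close>

text \<open>The zero block of the permuted matrix occupies the rows from \<open>r\<close> on and the
  columns before \<open>r\<close>, so \<open>S\<close> is the image of the trailing indices.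
  Conversely, a permutation listing the complement of \<open>S\<close> first and \<open>S\<close>
  last produces such a block.\<close>

lemma irreducible_mat_iff_irred_on:
  assumes B: "B \<in> carrier_mat k k"
  shows "irreducible_mat B \<longleftrightarrow> irred_on (\<lambda>i j. B $$ (i,j)) {..<k}"
proof -
  have "reducible_mat B \<longleftrightarrow> (\<exists>S. S \<noteq> {} \<and> S \<subset> {..<k} \<and> (\<forall>i\<in>S. \<forall>j\<in>{..<k} - S. B $$ (i,j) = 0))"
  proof
    assume "reducible_mat B"
    then obtain n r p A11 A12 A22 where B': "B \<in> carrier_mat n n" and r: "0 < r" "r < n"
      and p: "p permutes {..<n}" and c: "A11 \<in> carrier_mat r r" "A12 \<in> carrier_mat r (n - r)"
        "A22 \<in> carrier_mat (n - r) (n - r)"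
      and eq: "mat n n (\<lambda>(i,j). B $$ (p i, p j)) = four_block_mat A11 A12 (0\<^sub>m (n - r) r) A22"
      unfolding reducible_mat_def by blast
    have n: "n = k" using B B' by auto
    have z: "B $$ (p i, p j) = 0" if "r \<le> i" "i < n" "j < r" for i j
    proof -
      have "mat n n (\<lambda>(i,j). B $$ (p i, p j)) $$ (i,j) = 0"
        unfolding eq using that r c by auto
      then show ?thesis using that r by simp
    qed
    have im: "p ` {..<n} = {..<n}" and inj: "inj p"
      using p by (auto simp: permutes_image permutes_inj)
    let ?S = "p ` {r..<n}"
    have s1: "?S \<noteq> {}" using r by auto
    have s2: "?S \<subset> {..<k}"
    proof -
      have "0 \<in> {..<n}" "0 \<notin> {r..<n}" "{r..<n} \<subseteq> {..<n}" using r by auto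
      then have "{r..<n} \<subset> {..<n}" by (metis psubsetI)
      then have "p ` {r..<n} \<subset> p ` {..<n}"
        using inj by (intro image_strict_mono inj_on_subset[OF inj]) simp_all
      then show ?thesis unfolding im unfolding n .
    qed
    have s3: "\<forall>i\<in>?S. \<forall>j\<in>{..<k} - ?S. B $$ (i,j) = 0"
    proof (intro ballI)
      fix i j assume i: "i \<in> ?S" and j: "j \<in> {..<k} - ?S"
      have "j \<in> p ` {..<n}" unfolding im using j n by simp
      then obtain j' where j': "j = p j'" "j' < n" by (auto simp only: image_iff lessThan_iff Bex_def)
      have "j' < r"
      proof (rule ccontr)
        assume "\<not> j' < r"
        then have "j \<in> ?S" unfolding j'(1) using j'(2) by (intro imageI) simp
        then show False using j by simp
      qed
      moreover obtain i' where "i = p i'" "r \<le> i'" "i' < n"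
        using i by (auto simp only: image_iff atLeastLessThan_iff Bex_def)
      ultimately show "B $$ (i,j) = 0" using j'(1) z by simp
    qed
    show "\<exists>S. S \<noteq> {} \<and> S \<subset> {..<k} \<and> (\<forall>i\<in>S. \<forall>j\<in>{..<k} - S. B $$ (i,j) = 0)"
      by (intro exI[of _ ?S] conjI s1 s2 s3)
  next
    assume "\<exists>S. S \<noteq> {} \<and> S \<subset> {..<k} \<and> (\<forall>i\<in>S. \<forall>j\<in>{..<k} - S. B $$ (i,j) = 0)"
    then obtain S where S': "S \<noteq> {} \<and> S \<subset> {..<k} \<and> (\<forall>i\<in>S. \<forall>j\<in>{..<k} - S. B $$ (i,j) = 0)" ..
    note S = S'[THEN conjunct1] S'[THEN conjunct2, THEN conjunct1] S'[THEN conjunct2, THEN conjunct2]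
    have S_sub: "S \<subseteq> {..<k}" by (rule psubset_imp_subset[OF S(2)])
    have finS: "finite S" by (rule finite_subset[OF S_sub]) simp
    define r where "r = card ({..<k} - S)"
    have cS: "card S = k - r"
      using card_Diff_subset[OF finS, of "{..<k}"] card_mono[of "{..<k}" S] S_sub by (simp add: r_def)
    have "card S < k" using psubset_card_mono[OF _ S(2)] by simp
    then have r0: "0 < r" using cS by simp
    have "0 < card S" using S(1) finS by (simp add: card_gt_0_iff)
    then have rk: "r < k" using cS by simp
    obtain f where f: "bij_betw f {..<r} ({..<k} - S)"
      using ex_bij_betw_nat_finite[of "{..<k} - S"] by (auto simp: r_def atLeast0LessThan)
    obtain g where g: "bij_betw g {r..<k} S"
      using finite_same_card_bij[of "{r..<k}" S] finS cS by auto
    \<comment> \<open>The last case, the identity from \<open>k\<close> on, is what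
      \<open>permutes\<close> asks for.\<close>
    define p where "p i = (if i < r then f i else if i < k then g i else i)" for i
    have p1: "bij_betw p {..<r} ({..<k} - S)"
      using f by (rule bij_betw_cong[THEN iffD1, rotated]) (simp add: p_def)
    have p2: "bij_betw p {r..<k} S"
      using g by (rule bij_betw_cong[THEN iffD1, rotated]) (simp add: p_def)
    have "bij_betw p ({..<r} \<union> {r..<k}) (({..<k} - S) \<union> S)"
      by (rule bij_betw_combine[OF p1 p2]) auto
    moreover have "{..<r} \<union> {r..<k} = {..<k}" "({..<k} - S) \<union> S = {..<k}" using rk S_sub by auto
    ultimately have "bij_betw p {..<k} {..<k}" by simp
    then have p: "p permutes {..<k}"
      by (rule bij_imp_permutes) (use rk in \<open>auto simp: p_def\<close>)
    let ?P = "\<lambda>i j. B $$ (p i, p j)"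
    have z: "?P i j = 0" if "r \<le> i" "i < k" "j < r" for i j
      using that S(3) bij_betw_apply[OF p2, of i] bij_betw_apply[OF p1, of j] by auto
    have "mat k k (\<lambda>(i,j). ?P i j) = four_block_mat (mat r r (\<lambda>(i,j). ?P i j))
        (mat r (k - r) (\<lambda>(i,j). ?P i (j + r))) (0\<^sub>m (k - r) r)
        (mat (k - r) (k - r) (\<lambda>(i,j). ?P (i + r) (j + r)))"
      using rk z by (intro eq_matI) auto
    then show "reducible_mat B"
      unfolding reducible_mat_def using B r0 rk p by (metis mat_carrier)
  qed
  then show ?thesis using B by (auto simp: irreducible_mat_def irred_on_def)
qed

section \<open>Ray patterns as alignment of phases\<close>

text \<open>For the explicit angles built from \<open>z\<close> in
  \<open>L_ray_iff_aligned_on\<close>, the two sides of each ray pattern congruence differ by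
  exactly one full turn, in one direction or the other.\<close>

lemma rcong_2piI:
  "x + 2 * pi = y \<Longrightarrow> [x = y] (rmod (2 * pi))" "y + 2 * pi = x \<Longrightarrow> [x = y] (rmod (2 * pi))"
  unfolding rcong_altdef by (rule exI[of _ 1], simp) (rule exI[of _ "-1"], simp)

text \<open>Translates an angle of the shape occurring in ray patterns into the factors of
  \<open>aligned_on\<close>; the summand \<open>pi\<close> accounts for the minus sign.\<close>

lemma cis_twist:
  "cis (pi + x - y + (if s < r then \<phi> else 0)) = - cis x * cnj (cis y) * lower_twist (cis \<phi>) r s"
proof -
  have pi: "cis (pi + t) = - cis t" for t by (simp only: cis_mult[symmetric] cis_pi) simp
  have "cis (pi + x - y + c) = - cis x * cnj (cis y) * cis c" for c
    using pi[of "x - y + c"] by (simp add: cis_cnj cis_mult algebra_simps)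
  from this[of \<phi>] this[of 0] show ?thesis by (simp add: lower_twist_def)
qed

text \<open>Off the diagonal and up to full turns, the congruences are solved by
  \<open>\<theta> r s = pi + \<zeta> r - \<zeta> s\<close>, plus \<open>\<phi>\<close> below the
  diagonal. A pattern thus amounts to one phase per index, the \<open>z\<close> of
  \<open>aligned_on\<close>. The unit diagonal forces the global factor \<open>cis \<eta>\<close> to
  be 1.\<close>

lemma L_ray_iff_aligned_on:
  assumes B: "B \<in> carrier_mat k k" and k: "0 < k" and one: "\<And>i. i < k \<Longrightarrow> B $$ (i,i) = 1"
  shows "B \<in> L_ray \<phi> k \<longleftrightarrow> aligned_on (\<lambda>i j. B $$ (i,j)) \<phi> {..<k}"
proof
  assume "B \<in> L_ray \<phi> k"
  then obtain \<eta> P where P: "ray_pattern \<phi> k P"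
    and BP: "\<forall>r<k. \<forall>s<k. B $$ (r,s) = cis \<eta> * of_real (cmod (B $$ (r,s))) * P $$ (r,s)"
    unfolding L_ray_def by blast
  from P obtain \<theta> where P_def: "P = mat k k (\<lambda>(r,s). cis (\<theta> r s))"
    and c1: "\<forall>r<k. \<forall>s<k. r \<noteq> s \<longrightarrow> [\<theta> r s + \<theta> s r = \<phi>] (rmod (2 * pi))"
    and c2: "\<forall>r<k. \<forall>s<k. \<forall>t<k. r < s \<and> s < t \<or> s < t \<and> t < r \<or> t < r \<and> r < s \<longrightarrow>
        [\<theta> r s - \<theta> r t = \<theta> t s - \<phi> + pi] (rmod (2 * pi))"
    and c3: "\<forall>r<k. \<forall>s<k. \<forall>t<k. r < t \<and> t < s \<or> t < s \<and> s < r \<or> s < r \<and> r < t \<longrightarrow>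
        [\<theta> r s - \<theta> r t = \<theta> t s + pi] (rmod (2 * pi))"
    and c4: "\<forall>r<k. \<theta> r r = 0"
    unfolding ray_pattern_def by blast
  have "B $$ (0,0) = cis \<eta> * of_real (cmod (B $$ (0,0))) * P $$ (0,0)" using BP k by blast
  then have eta: "cis \<eta> = 1" using one[OF k] c4 k by (simp add: P_def)
  have B\<theta>: "B $$ (r,s) = of_real (cmod (B $$ (r,s))) * cis (\<theta> r s)" if "r < k" "s < k" for r s
    using BP[rule_format, OF that] eta that by (simp add: P_def)
  (* The phases are read off the first row. *)
  define \<zeta> where "\<zeta> s = (if s = 0 then 0 else pi - \<theta> 0 s)" for s
  have \<theta>: "[\<theta> r s = pi + \<zeta> r - \<zeta> s + (if s < r then \<phi> else 0)] (rmod (2 * pi))"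
    if rs: "r < k" "s < k" "r \<noteq> s" for r s
  proof -
    \<comment> \<open>Row 0 holds by the choice of \<open>\<zeta>\<close>, column 0 by the first
      congruence. The remaining positions use the triple \<open>(0, s, r)\<close>, whose cyclic
      order selects the second congruence for \<open>s < r\<close> and the third for
      \<open>r < s\<close>.\<close>
    consider "r = 0" "0 < s" | "s = 0" "0 < r" | "0 < s" "s < r" | "0 < r" "r < s"
      using rs(3) by linarith
    then show ?thesis
    proof cases
      case 1
      then show ?thesis by (simp add: \<zeta>_def)
    next
      case 2
      then obtain m where "\<phi> = \<theta> 0 r + \<theta> r 0 + of_int m * (2 * pi)"
        using c1[rule_format, of 0 r] rs by (auto simp: rcong_altdef)
      then show ?thesis using 2 unfolding rcong_altdef
        by (intro exI[of _ "m + 1"]) (simp add: \<zeta>_def algebra_simps)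
    next
      case 3
      then obtain m where "\<theta> r s - \<phi> + pi = \<theta> 0 s - \<theta> 0 r + of_int m * (2 * pi)"
        using c2[rule_format, of 0 s r] rs by (auto simp: rcong_altdef)
      then show ?thesis using 3 unfolding rcong_altdef
        by (intro exI[of _ "1 - m"]) (simp add: \<zeta>_def algebra_simps)
    next
      case 4
      then obtain m where "\<theta> r s + pi = \<theta> 0 s - \<theta> 0 r + of_int m * (2 * pi)"
        using c3[rule_format, of 0 s r] rs by (auto simp: rcong_altdef)
      then show ?thesis using 4 unfolding rcong_altdef
        by (intro exI[of _ "1 - m"]) (simp add: \<zeta>_def algebra_simps)
    qed
  qed
  show "aligned_on (\<lambda>i j. B $$ (i,j)) \<phi> {..<k}"
    unfolding aligned_on_def
  proof (intro exI[of _ "\<lambda>i. cis (\<zeta> i)"] conjI ballI impI)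
    fix r s assume "r \<in> {..<k}" "s \<in> {..<k}" "r \<noteq> s"
    then have rs: "r < k" "s < k" "r \<noteq> s" by auto
    have "cis (\<theta> r s) = cis (pi + \<zeta> r - \<zeta> s + (if s < r then \<phi> else 0))"
      using \<theta>[OF rs] by (simp add: cis_eq_iff)
    also have "\<dots> = - cis (\<zeta> r) * cnj (cis (\<zeta> s)) * lower_twist (cis \<phi>) r s"
      by (rule cis_twist)
    finally show "B $$ (r,s) / B $$ (r,r) = - of_real (cmod (B $$ (r,s) / B $$ (r,r))) *
        cis (\<zeta> r) * cnj (cis (\<zeta> s)) * lower_twist (cis \<phi>) r s"
      using B\<theta>[OF rs(1,2)] one[OF rs(1)] by (simp add: mult_ac)
  qed simp
next
  assume "aligned_on (\<lambda>i j. B $$ (i,j)) \<phi> {..<k}"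
  then obtain z where z1: "\<And>r. r < k \<Longrightarrow> cmod (z r) = 1" and
    z: "\<And>r s. r < k \<Longrightarrow> s < k \<Longrightarrow> r \<noteq> s \<Longrightarrow> B $$ (r,s) / B $$ (r,r) =
      - of_real (cmod (B $$ (r,s) / B $$ (r,r))) * z r * cnj (z s) * lower_twist (cis \<phi>) r s"
    unfolding aligned_on_def by blast
  \<comment> \<open>The diagonal is set to 0 separately, since the general formula would give
    \<open>pi\<close> there.\<close>
  define \<theta> where "\<theta> r s = (if r = s then 0 else pi + Arg (z r) - Arg (z s) + (if s < r then \<phi> else 0))" for r s
  define P where "P = mat k k (\<lambda>(r,s). cis (\<theta> r s))"
  have "ray_pattern \<phi> k P"
    unfolding ray_pattern_def
  proof (intro exI[of _ \<theta>] conjI allI impI)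
    show "P = mat k k (\<lambda>(r,s). cis (\<theta> r s))" by (simp add: P_def)
  next
    fix r s :: nat assume "r \<noteq> s"
    then show "[\<theta> r s + \<theta> s r = \<phi>] (rmod (2 * pi))"
      by (intro rcong_2piI) (auto simp: \<theta>_def)
  next
    fix r s t :: nat assume "r < s \<and> s < t \<or> s < t \<and> t < r \<or> t < r \<and> r < s"
    then show "[\<theta> r s - \<theta> r t = \<theta> t s - \<phi> + pi] (rmod (2 * pi))"
      by (intro rcong_2piI(1)) (auto simp: \<theta>_def)
  next
    fix r s t :: nat assume "r < t \<and> t < s \<or> t < s \<and> s < r \<or> s < r \<and> r < t"
    then show "[\<theta> r s - \<theta> r t = \<theta> t s + pi] (rmod (2 * pi))"
      by (intro rcong_2piI(1)) (auto simp: \<theta>_def)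
  qed (simp add: \<theta>_def)
  moreover have "B $$ (r,s) = cis 0 * of_real (cmod (B $$ (r,s))) * P $$ (r,s)" if rs: "r < k" "s < k" for r s
  proof (cases "r = s")
    case True
    then show ?thesis using rs one by (simp add: P_def \<theta>_def)
  next
    case False
    have za: "cis (Arg (z i)) = z i" if "i < k" for i
      using z1[OF that] cis_Arg[of "z i"] by (cases "z i = 0") (auto simp: sgn_eq)
    have "cis (\<theta> r s) = - cis (Arg (z r)) * cnj (cis (Arg (z s))) * lower_twist (cis \<phi>) r s"
      using False by (simp add: \<theta>_def cis_twist)
    then show ?thesis using z[OF rs False] one rs by (simp add: P_def za mult_ac)
  qed
  ultimately show "B \<in> L_ray \<phi> k" using B unfolding L_ray_def by blast
qed

section \<open>Equipotent classes, inverses and diagonal scaling\<close>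

lemma GDE_mats_iff_equi_on:
  assumes "B \<in> carrier_mat k k"
  shows "B \<in> GDE_mats k \<longleftrightarrow> (\<exists>\<beta>. (\<forall>i\<in>{..<k}. \<beta> i > 0) \<and> equi_on (\<lambda>i j. B $$ (i,j)) \<beta> {..<k})"
  using assms by (simp add: GDE_mats_def equi_on_def Ball_def)

lemma DE_mats_iff_equi_on:
  assumes "B \<in> carrier_mat k k"
  shows "B \<in> DE_mats k \<longleftrightarrow> equi_on (\<lambda>i j. B $$ (i,j)) (\<lambda>_. 1) {..<k}"
  using assms by (simp add: DE_mats_def equi_on_def Ball_def)

lemma inv_mat_inverse:
  assumes M: "M \<in> carrier_mat n n" and d: "det M \<noteq> 0"
  shows "inv_mat M \<in> carrier_mat n n" "M * inv_mat M = 1\<^sub>m n" "inv_mat M * M = 1\<^sub>m n"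
proof -
  have "M \<in> Units (ring_mat TYPE(complex) n ())" by (rule det_non_zero_imp_unit[OF M d])
  then obtain W where "mat_inverse M = Some W"
    using mat_inverse(1)[OF M, where b = "()"] by (cases "mat_inverse M") auto
  then show "inv_mat M \<in> carrier_mat n n" "M * inv_mat M = 1\<^sub>m n" "inv_mat M * M = 1\<^sub>m n"
    using mat_inverse(2)[OF M, of W] by auto
qed

lemma inv_mat_diag_mult:
  assumes B: "B \<in> carrier_mat k k" and nz: "\<And>i. i < k \<Longrightarrow> B $$ (i,i) \<noteq> 0"
  shows "inv_mat (diag_part B) * B = mat k k (\<lambda>(i,j). B $$ (i,j) / B $$ (i,i))"
proof -
  let ?D = "mat_diag k (\<lambda>i. B $$ (i,i))"
  let ?E = "mat_diag k (\<lambda>i. 1 / B $$ (i,i))"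
  have D: "diag_part B = ?D" using B by (simp add: diag_part_def)
  have DE: "?D * ?E = 1\<^sub>m k"
    using nz by (intro eq_matI) (simp_all, simp_all add: mat_diag_def)
  have "det ?D * det ?E = 1"
    by (simp only: det_mult[OF mat_diag_dim mat_diag_dim, symmetric] DE det_one)
  then have "det ?D \<noteq> 0" by auto
  note W = inv_mat_inverse[OF mat_diag_dim this]
  \<comment> \<open>Associativity identifies the left inverse with the explicit right inverse
    \<open>?E\<close>.\<close>
  have "inv_mat ?D = inv_mat ?D * (?D * ?E)" using W by (simp only: DE right_mult_one_mat)
  also have "\<dots> = (inv_mat ?D * ?D) * ?E"
    by (rule assoc_mult_mat[symmetric, OF W(1) mat_diag_dim mat_diag_dim])
  also have "\<dots> = ?E" unfolding W(3) by (rule left_mult_one_mat[OF mat_diag_dim])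
  finally show ?thesis using B by (simp add: D mat_diag_mult_left[OF B])
qed

section \<open>The backward Gauss-Seidel iteration\<close>

definition twist_mat :: "complex \<Rightarrow> complex mat \<Rightarrow> complex mat" where
  "twist_mat c A = mat (dim_row A) (dim_col A) (\<lambda>(i,j). lower_twist c i j * A $$ (i,j))"

lemma twist_mat_carrier: "A \<in> carrier_mat n n \<Longrightarrow> twist_mat c A \<in> carrier_mat n n"
  by (simp add: twist_mat_def)

lemma twist_mat_1: "twist_mat 1 A = A"
  by (intro eq_matI) (auto simp: twist_mat_def lower_twist_def)

lemma smult_mat_mult_vec:
  assumes "M \<in> carrier_mat n n" "v \<in> carrier_vec n"
  shows "((c::complex) \<cdot>\<^sub>m M) *\<^sub>v v = c \<cdot>\<^sub>v (M *\<^sub>v v)"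
  using assms by (intro eq_vecI) (auto simp: scalar_prod_def sum_distrib_left mult.assoc)

text \<open>The part that each sweep inverts: \<open>A\<close> equals
  \<open>backward_part A - lower_part A\<close>.\<close>

definition backward_part :: "complex mat \<Rightarrow> complex mat" where
  "backward_part A = diag_part A - upper_part A"

context
  fixes A :: "complex mat" and n :: nat
  assumes A: "A \<in> carrier_mat n n" and nz: "\<And>i. i < n \<Longrightarrow> A $$ (i,i) \<noteq> 0"
begin

lemma lower_part_carrier: "lower_part A \<in> carrier_mat n n"
  using A by (simp add: lower_part_def)

lemma backward_part_carrier: "backward_part A \<in> carrier_mat n n"
  using A unfolding carrier_mat_def by (simp add: backward_part_def diag_part_def upper_part_def mat_diag_def)

lemma twist_mat_splitting: "twist_mat c A = (backward_part A) - c \<cdot>\<^sub>m lower_part A"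
  using A by (intro eq_matI)
    (auto simp: twist_mat_def lower_twist_def backward_part_def diag_part_def upper_part_def lower_part_def mat_diag_def)

lemma det_backward_part: "det (backward_part A) \<noteq> 0"
proof -
  have "upper_triangular (backward_part A)"
    using A by (auto simp: backward_part_def diag_part_def upper_part_def mat_diag_def upper_triangular_def)
  moreover have "0 \<notin> set (diag_mat (backward_part A))"
    using A nz by (auto simp: diag_mat_def backward_part_def diag_part_def upper_part_def mat_diag_def)
  ultimately show ?thesis
    using upper_triangular_imp_det_eq_0_iff[OF backward_part_carrier] by blast
qed

lemmas inv_backward_part = inv_mat_inverse[OF backward_part_carrier det_backward_part]

lemma H_BGS_eq: "H_BGS A = inv_mat (backward_part A) * lower_part A"
  by (simp add: H_BGS_def backward_part_def)

lemma H_BGS_carrier: "H_BGS A \<in> carrier_mat n n"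
  using inv_backward_part lower_part_carrier by (simp add: H_BGS_eq)

lemma H_BGS_mult_vec:
  assumes "v \<in> carrier_vec n"
  shows "H_BGS A *\<^sub>v v = inv_mat (backward_part A) *\<^sub>v (lower_part A *\<^sub>v v)"
  unfolding H_BGS_eq by (rule assoc_mult_mat_vec[OF inv_backward_part(1) lower_part_carrier assms])

lemma twist_mat_mult_vec:
  assumes v: "v \<in> carrier_vec n"
  shows "twist_mat c A *\<^sub>v v = (backward_part A) *\<^sub>v v - c \<cdot>\<^sub>v (lower_part A *\<^sub>v v)"
  unfolding twist_mat_splitting
  using minus_mult_distrib_mat_vec[OF backward_part_carrier _ v] smult_mat_mult_vec[OF lower_part_carrier v]
    lower_part_carrier by simp

text \<open>Multiplying \<open>H v = \<mu> v\<close> by \<open>D - U\<close> gives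
  \<open>L v = \<mu> (D - U) v\<close>; division by \<open>\<mu>\<close> turns this into
  \<open>(D - U - L / \<mu>) v = 0\<close>, the kernel equation of the twisted matrix.\<close>

lemma eigenvalue_H_BGS_iff:
  assumes l: "\<mu> \<noteq> 0"
  shows "eigenvalue (H_BGS A) \<mu> \<longleftrightarrow> det (twist_mat (1 / \<mu>) A) = 0"
proof -
  let ?N = "backward_part A" and ?W = "inv_mat (backward_part A)" and ?L = "lower_part A"
  have WN: "?W *\<^sub>v (?N *\<^sub>v v) = v" and NW: "?N *\<^sub>v (?W *\<^sub>v v) = v" if "v \<in> carrier_vec n" for v
    using that inv_backward_part backward_part_carrier
    by (simp_all flip: assoc_mult_mat_vec)
  have iff: "H_BGS A *\<^sub>v v = \<mu> \<cdot>\<^sub>v v \<longleftrightarrow> twist_mat (1 / \<mu>) A *\<^sub>v v = 0\<^sub>v n" if v: "v \<in> carrier_vec n" for v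
  proof -
    have Nv: "?N *\<^sub>v v \<in> carrier_vec n" and Lv: "?L *\<^sub>v v \<in> carrier_vec n"
      using backward_part_carrier lower_part_carrier v by auto
    have "twist_mat (1 / \<mu>) A *\<^sub>v v = 0\<^sub>v n \<longleftrightarrow> ?L *\<^sub>v v = \<mu> \<cdot>\<^sub>v (?N *\<^sub>v v)"
    proof
      assume z: "twist_mat (1 / \<mu>) A *\<^sub>v v = 0\<^sub>v n"
      show "?L *\<^sub>v v = \<mu> \<cdot>\<^sub>v (?N *\<^sub>v v)"
      proof (rule eq_vecI)
        fix i assume "i < dim_vec (\<mu> \<cdot>\<^sub>v (?N *\<^sub>v v))"
        then have i: "i < n" using backward_part_carrier by simp
        have "(?N *\<^sub>v v - (1 / \<mu>) \<cdot>\<^sub>v (?L *\<^sub>v v)) $ i = 0"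
          using z i unfolding twist_mat_mult_vec[OF v] by simp
        then have "(?N *\<^sub>v v) $ i = (1 / \<mu>) * (?L *\<^sub>v v) $ i"
          using i backward_part_carrier lower_part_carrier by (simp del: index_mult_mat_vec)
        then show "(?L *\<^sub>v v) $ i = (\<mu> \<cdot>\<^sub>v (?N *\<^sub>v v)) $ i"
          using i backward_part_carrier l by (simp del: index_mult_mat_vec)
      qed (use backward_part_carrier lower_part_carrier in simp)
    next
      assume "?L *\<^sub>v v = \<mu> \<cdot>\<^sub>v (?N *\<^sub>v v)"
      then show "twist_mat (1 / \<mu>) A *\<^sub>v v = 0\<^sub>v n"
        unfolding twist_mat_mult_vec[OF v] using l Nv by (simp add: smult_smult_assoc)
    qed
    also have "\<dots> \<longleftrightarrow> ?W *\<^sub>v (?L *\<^sub>v v) = \<mu> \<cdot>\<^sub>v v"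
    proof
      assume "?L *\<^sub>v v = \<mu> \<cdot>\<^sub>v (?N *\<^sub>v v)"
      then show "?W *\<^sub>v (?L *\<^sub>v v) = \<mu> \<cdot>\<^sub>v v"
        using mult_mat_vec[OF inv_backward_part(1) Nv] WN[OF v] by simp
    next
      assume e: "?W *\<^sub>v (?L *\<^sub>v v) = \<mu> \<cdot>\<^sub>v v"
      have "?L *\<^sub>v v = ?N *\<^sub>v (\<mu> \<cdot>\<^sub>v v)" using NW[OF Lv] e by simp
      then show "?L *\<^sub>v v = \<mu> \<cdot>\<^sub>v (?N *\<^sub>v v)"
        using mult_mat_vec[OF backward_part_carrier v] by simp
    qed
    finally show ?thesis using H_BGS_mult_vec[OF v] by simp
  qed
  show ?thesis
    unfolding eigenvalue_def eigenvector_def det_0_iff_vec_prod_zero[OF twist_mat_carrier[OF A]]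
    using H_BGS_carrier iff by auto
qed

text \<open>With \<open>A = N - L\<close> and \<open>W\<close> the inverse of \<open>N\<close>, one
  has \<open>W A x = x - W L x\<close>; solutions of the system are thus fixed points of the
  sweep.\<close>

lemma H_BGS_fixed_point:
  assumes x: "x \<in> carrier_vec n"
  shows "H_BGS A *\<^sub>v x + inv_mat (backward_part A) *\<^sub>v (A *\<^sub>v x) = x"
proof -
  let ?W = "inv_mat (backward_part A)" and ?N = "backward_part A" and ?L = "lower_part A"
  have Ax: "A *\<^sub>v x = ?N *\<^sub>v x - ?L *\<^sub>v x"
    using twist_mat_mult_vec[OF x, of 1] twist_mat_1[of A] lower_part_carrier x by (simp add: one_smult_vec)
  have Nx: "?N *\<^sub>v x \<in> carrier_vec n" and Lx: "?L *\<^sub>v x \<in> carrier_vec n"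
    using backward_part_carrier lower_part_carrier x by auto
  have "?W *\<^sub>v (?N *\<^sub>v x) = x"
    using x inv_backward_part backward_part_carrier by (simp flip: assoc_mult_mat_vec)
  then have e: "?W *\<^sub>v (A *\<^sub>v x) = x - H_BGS A *\<^sub>v x"
    unfolding Ax H_BGS_mult_vec[OF x] mult_minus_distrib_mat_vec[OF inv_backward_part(1) Nx Lx] by simp
  have "H_BGS A *\<^sub>v x \<in> carrier_vec n" using H_BGS_carrier x by auto
  moreover have "y + (x - y) = x" if "y \<in> carrier_vec n" for y
    using x that by (intro eq_vecI) auto
  ultimately show ?thesis unfolding e by blast
qed

text \<open>Subtracting the fixed point equation from a sweep cancels \<open>b\<close>, so each
  sweep multiplies the error by \<open>H_BGS A\<close>.\<close>

lemma bgs_iter_eq: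
  assumes x: "x \<in> carrier_vec n" and x0: "x0 \<in> carrier_vec n" and b: "A *\<^sub>v x = b"
  shows "bgs_iter A b x0 k = x + H_BGS A ^\<^sub>m k *\<^sub>v (x0 - x)"
proof (induction k)
  case 0
  have "dim_row (H_BGS A) = n" using H_BGS_carrier by simp
  then show ?case using x x0 by (intro eq_vecI) auto
next
  case (Suc k)
  let ?H = "H_BGS A" and ?d = "x0 - x"
  have d: "?d \<in> carrier_vec n" using x x0 by simp
  have pow: "?H ^\<^sub>m k \<in> carrier_mat n n" using H_BGS_carrier by simp
  have Hx: "?H *\<^sub>v x \<in> carrier_vec n" and Hd: "?H *\<^sub>v (?H ^\<^sub>m k *\<^sub>v ?d) \<in> carrier_vec n"
    by (intro mult_mat_vec_carrier[OF H_BGS_carrier] mult_mat_vec_carrier[OF pow] d x)+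
  \<comment> \<open>The power \<open>^\<^sub>m\<close> appends the new factor on the right, whereas
    a sweep multiplies from the left.\<close>
  have comm: "?H * ?H ^\<^sub>m m = ?H ^\<^sub>m Suc m" for m
  proof (induction m)
    case 0
    then show ?case using H_BGS_carrier by simp
  next
    case (Suc m)
    have "?H * ?H ^\<^sub>m Suc m = (?H * ?H ^\<^sub>m m) * ?H"
      using H_BGS_carrier by (simp add: assoc_mult_mat[of _ n n _ n _ n])
    then show ?case using Suc by simp
  qed
  have w: "inv_mat (backward_part A) *\<^sub>v b \<in> carrier_vec n"
    unfolding b[symmetric] using A x inv_backward_part(1) by (meson mult_mat_vec_carrier)
  have "bgs_iter A b x0 (Suc k) =
      ?H *\<^sub>v (x + ?H ^\<^sub>m k *\<^sub>v ?d) + inv_mat (backward_part A) *\<^sub>v b"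
    by (simp add: Suc backward_part_def)
  also have "?H *\<^sub>v (x + ?H ^\<^sub>m k *\<^sub>v ?d) = ?H *\<^sub>v x + ?H *\<^sub>v (?H ^\<^sub>m k *\<^sub>v ?d)"
    by (rule mult_add_distrib_mat_vec[OF H_BGS_carrier x]) (use pow d in auto)
  also have "\<dots> + inv_mat (backward_part A) *\<^sub>v b =
      (?H *\<^sub>v x + inv_mat (backward_part A) *\<^sub>v b) + ?H *\<^sub>v (?H ^\<^sub>m k *\<^sub>v ?d)"
    by (simp only: assoc_add_vec[OF Hx Hd w] comm_add_vec[OF Hd w] assoc_add_vec[OF Hx w Hd])
  also have "?H *\<^sub>v x + inv_mat (backward_part A) *\<^sub>v b = x"
    using H_BGS_fixed_point[OF x] b by simp
  also have "?H *\<^sub>v (?H ^\<^sub>m k *\<^sub>v ?d) = ?H ^\<^sub>m Suc k *\<^sub>v ?d"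
    using assoc_mult_mat_vec[OF H_BGS_carrier pow d] comm by simp
  finally show ?case .
qed

end

section \<open>Decay of matrix powers and convergence of the scheme\<close>

lemma pow_mat_smult:
  assumes H: "H \<in> carrier_mat n n"
  shows "((c::complex) \<cdot>\<^sub>m H) ^\<^sub>m k = c ^ k \<cdot>\<^sub>m (H ^\<^sub>m k)"
proof (induction k)
  case 0
  then show ?case by (intro eq_matI) auto
next
  case (Suc k)
  have "(c \<cdot>\<^sub>m H) ^\<^sub>m Suc k = c ^ k \<cdot>\<^sub>m (H ^\<^sub>m k) * (c \<cdot>\<^sub>m H)" using Suc by simp
  also have "\<dots> = c ^ k \<cdot>\<^sub>m (c \<cdot>\<^sub>m (H ^\<^sub>m k * H))"
    using mult_smult_assoc_mat[of "H ^\<^sub>m k" n n "c \<cdot>\<^sub>m H" n] mult_smult_distrib[of "H ^\<^sub>m k" n n H n] H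
    by simp
  finally show ?case using H by (intro eq_matI) (auto simp: mult_ac)
qed

text \<open>For \<open>r\<close> strictly between the spectral radius and 1, the matrix
  \<open>H / r\<close> still has spectral radius below 1. Its powers are therefore bounded, and the
  entries of the powers of \<open>H\<close> decay like \<open>r ^ k\<close>.\<close>

lemma pow_mat_tendsto_0:
  assumes H: "H \<in> carrier_mat n n" and n: "0 < n" and sr: "spectral_radius H < 1"
    and ij: "i < n" "j < n"
  shows "(\<lambda>k. (H ^\<^sub>m k) $$ (i,j)) \<longlonglongrightarrow> 0"
proof -
  have sr0: "0 \<le> spectral_radius H" using spectral_radius_mem_max(1)[OF H n] by auto
  define r where "r = (spectral_radius H + 1) / 2"
  have r: "0 < r" "r < 1" "spectral_radius H < r" using sr sr0 by (auto simp: r_def)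
  define c where "c = complex_of_real (1 / r)"
  have c: "c \<noteq> 0" using r by (simp add: c_def)
  let ?G = "c \<cdot>\<^sub>m H"
  have G: "?G \<in> carrier_mat n n" using H by simp
  obtain ev where ev: "eigenvalue ?G ev" "cmod ev = spectral_radius ?G"
    using spectral_radius_mem_max(1)[OF G n] by (auto simp: spectrum_def)
  then obtain v where v: "v \<in> carrier_vec n" "v \<noteq> 0\<^sub>v n" "?G *\<^sub>v v = ev \<cdot>\<^sub>v v"
    using H by (auto simp: eigenvalue_def eigenvector_def)
  have "c \<cdot>\<^sub>v (H *\<^sub>v v) = ev \<cdot>\<^sub>v v" using v smult_mat_mult_vec[OF H v(1)] by simp
  then have "(1 / c) \<cdot>\<^sub>v (c \<cdot>\<^sub>v (H *\<^sub>v v)) = (1 / c) \<cdot>\<^sub>v (ev \<cdot>\<^sub>v v)" by simp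
  then have "H *\<^sub>v v = (ev / c) \<cdot>\<^sub>v v" using c by (simp add: smult_smult_assoc)
  then have "eigenvalue H (ev / c)" using v H by (auto simp: eigenvalue_def eigenvector_def)
  then have "cmod (ev / c) \<le> spectral_radius H"
    using spectral_radius_mem_max(2)[OF H n] by (auto simp: spectrum_def)
  then have "cmod ev * r \<le> spectral_radius H" using r by (simp add: c_def norm_mult)
  then have "cmod ev * r < r" using r by linarith
  then have "spectral_radius ?G < 1" using r ev by simp
  then obtain C where C: "\<And>k. norm_bound (?G ^\<^sub>m k) C"
    using spectral_radius_jnf_norm_bound_less_1_upper_triangular[OF G] by blast
  have bound: "cmod ((H ^\<^sub>m k) $$ (i,j)) \<le> C * r ^ k" for k
  proof -
    have "cmod ((?G ^\<^sub>m k) $$ (i,j)) \<le> C"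
      using C[of k] ij H unfolding norm_bound_def by simp
    then have "cmod (c ^ k) * cmod ((H ^\<^sub>m k) $$ (i,j)) \<le> C"
      using ij H by (simp add: pow_mat_smult[OF H] norm_mult)
    then show ?thesis using r by (simp add: c_def norm_power norm_divide power_divide field_simps)
  qed
  have "(\<lambda>k. C * r ^ k) \<longlonglongrightarrow> 0"
    using r LIMSEQ_power_zero[of r] tendsto_mult_right_zero by fastforce
  then have "(\<lambda>k. cmod ((H ^\<^sub>m k) $$ (i,j))) \<longlonglongrightarrow> 0"
    by (rule tendsto_sandwich[OF _ _ tendsto_const[of 0], rotated -1])
      (simp_all add: bound)
  then show ?thesis by (rule tendsto_norm_zero_cancel)
qed

text \<open>Decay of the powers makes every initial error vanish. Conversely, if the spectral radius
  is at least 1, starting at the solution plus an eigenvector for an eigenvalue of maximal modulus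
  keeps the error away from 0. The argument works for each single \<open>b\<close>.\<close>

lemma bgs_convergent_iff:
  assumes n: "n \<ge> 1" and A: "A \<in> carrier_mat n n" and nz: "\<And>i. i < n \<Longrightarrow> A $$ (i,i) \<noteq> 0"
    and b: "b \<in> carrier_vec n"
  shows "spectral_radius (H_BGS A) < 1 \<longleftrightarrow> bgs_convergent n A b"
proof
  have H: "H_BGS A \<in> carrier_mat n n" by (rule H_BGS_carrier[OF A nz])
  assume sr: "spectral_radius (H_BGS A) < 1"
  \<comment> \<open>The twist by 1 is \<open>A\<close> itself, so a singular \<open>A\<close> would
    make 1 an eigenvalue of the iteration matrix.\<close>
  have "det A \<noteq> 0"
  proof
    assume "det A = 0"
    then have "eigenvalue (H_BGS A) 1" using eigenvalue_H_BGS_iff[OF A nz, of 1] by (simp add: twist_mat_1)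
    then show False using spectral_radius_mem_max(2)[OF H, of "cmod 1"] n sr by (force simp: spectrum_def)
  qed
  note W = inv_mat_inverse[OF A this]
  define x where "x = inv_mat A *\<^sub>v b"
  have x: "x \<in> carrier_vec n" using W(1) b by (auto simp: x_def)
  have Ax: "A *\<^sub>v x = b"
    unfolding x_def using W A b by (simp flip: assoc_mult_mat_vec)
  have uniq: "y = x" if "y \<in> carrier_vec n" "A *\<^sub>v y = b" for y
    unfolding x_def that(2)[symmetric] using W A that(1) by (simp flip: assoc_mult_mat_vec)
  have "vec_tendsto n (bgs_iter A b x0) x" if x0: "x0 \<in> carrier_vec n" for x0
    unfolding vec_tendsto_def
  proof (intro allI impI)
    fix j assume j: "j < n"
    have e: "bgs_iter A b x0 k $ j = x $ j + (\<Sum>i<n. (H_BGS A ^\<^sub>m k) $$ (j,i) * (x0 - x) $ i)" for k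
    proof -
      have "bgs_iter A b x0 k = x + H_BGS A ^\<^sub>m k *\<^sub>v (x0 - x)"
        by (rule bgs_iter_eq[OF A nz x x0 Ax])
      then show ?thesis using j x x0 H
        by (simp add: scalar_prod_def atLeast0LessThan)
    qed
    have "(\<lambda>k. \<Sum>i<n. (H_BGS A ^\<^sub>m k) $$ (j,i) * (x0 - x) $ i) \<longlonglongrightarrow> (\<Sum>i<n. 0 * (x0 - x) $ i)"
      using n j by (intro tendsto_sum tendsto_mult tendsto_const pow_mat_tendsto_0[OF H _ sr]) auto
    from tendsto_add[OF tendsto_const[of "x $ j"] this]
    show "(\<lambda>k. bgs_iter A b x0 k $ j) \<longlonglongrightarrow> x $ j" unfolding e by simp
  qed
  then show "bgs_convergent n A b"
    unfolding bgs_convergent_def by (intro bexI[OF _ x] conjI Ax) (simp_all add: uniq)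
next
  have H: "H_BGS A \<in> carrier_mat n n" by (rule H_BGS_carrier[OF A nz])
  assume "bgs_convergent n A b"
  then obtain x where x: "x \<in> carrier_vec n" "A *\<^sub>v x = b" and
    lim: "\<And>x0. x0 \<in> carrier_vec n \<Longrightarrow> vec_tendsto n (bgs_iter A b x0) x"
    unfolding bgs_convergent_def by blast
  show "spectral_radius (H_BGS A) < 1"
  proof (rule ccontr)
    assume "\<not> spectral_radius (H_BGS A) < 1"
    moreover obtain \<mu> where l: "eigenvalue (H_BGS A) \<mu>" "cmod \<mu> = spectral_radius (H_BGS A)"
      using spectral_radius_mem_max(1)[OF H] n by (auto simp: spectrum_def)
    ultimately have l1: "1 \<le> cmod \<mu>" by simp
    obtain v where ev: "eigenvector (H_BGS A) v \<mu>" using l by (auto simp: eigenvalue_def)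
    then have v: "v \<in> carrier_vec n" "v \<noteq> 0\<^sub>v n" using H by (auto simp: eigenvector_def)
    obtain j where j: "j < n" "v $ j \<noteq> 0"
      using v by (metis carrier_vecD eq_vecI index_zero_vec(1) index_zero_vec(2))
    have xv: "x + v \<in> carrier_vec n" "x + v - x = v" using x v by auto
    have iter: "bgs_iter A b (x + v) k $ j = x $ j + \<mu> ^ k * v $ j" for k
    proof -
      have "bgs_iter A b (x + v) k = x + H_BGS A ^\<^sub>m k *\<^sub>v (x + v - x)"
        by (rule bgs_iter_eq[OF A nz x(1) xv(1) x(2)])
      then show ?thesis using x v j unfolding xv(2) eigenvector_pow[OF H ev] by simp
    qed
    have "(\<lambda>k. bgs_iter A b (x + v) k $ j) \<longlonglongrightarrow> x $ j"
      using lim[OF xv(1)] j by (simp add: vec_tendsto_def)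
    then have "(\<lambda>k. x $ j + \<mu> ^ k * v $ j) \<longlonglongrightarrow> x $ j" unfolding iter .
    then have "(\<lambda>k. (x $ j + \<mu> ^ k * v $ j) - x $ j) \<longlonglongrightarrow> x $ j - x $ j"
      by (intro tendsto_diff tendsto_const)
    then have lim0: "(\<lambda>k. cmod (\<mu> ^ k * v $ j)) \<longlonglongrightarrow> 0" by (simp add: tendsto_norm_zero)
    have ge: "cmod (v $ j) \<le> cmod (\<mu> ^ k * v $ j)" for k
      using one_le_power[OF l1, of k] by (simp add: norm_mult norm_power mult_le_cancel_right1)
    have "cmod (v $ j) \<le> 0" by (rule LIMSEQ_le_const[OF lim0]) (use ge in blast)
    then show False using j by simp
  qed
qed

section \<open>Principal submatrices and the convergence criterion\<close>

lemma bij_betw_pick: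
  assumes "finite I"
  shows "bij_betw (pick I) {..<card I} I"
proof -
  have inj: "inj_on (pick I) {..<card I}"
    by (rule linorder_inj_onI) (use pick_mono_le[of _ I] in fastforce)+
  moreover have "pick I ` {..<card I} \<subseteq> I" using pick_in_set_le by auto
  ultimately show ?thesis
    using assms by (metis bij_betw_def card_image card_lessThan card_subset_eq)
qed

lemma strict_mono_on_pick: "strict_mono_on {..<card I} (pick I)"
  by (auto simp: strict_mono_on_def intro: pick_mono_le)

lemma submatrix_principal:
  assumes A: "A \<in> carrier_mat n n" and I: "I \<subseteq> {..<n}"
  shows "submatrix A I I = mat (card I) (card I) (\<lambda>(r,s). A $$ (pick I r, pick I s))"
proof -
  have "{i. i < n \<and> i \<in> I} = I" using I by auto
  then show ?thesis using A by (simp add: submatrix_def)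
qed

context
  fixes A :: "complex mat" and n :: nat and I :: "nat set"
  assumes A: "A \<in> carrier_mat n n" and nz: "\<And>i. i < n \<Longrightarrow> A $$ (i,i) \<noteq> 0" and I: "I \<subseteq> {..<n}"
begin

lemma diag_pick_nonzero: "r < card I \<Longrightarrow> A $$ (pick I r, pick I r) \<noteq> 0"
  using nz pick_in_set_le[of r I] I by auto

lemma scaled_submatrix:
  "inv_mat (diag_part (submatrix A I I)) * submatrix A I I =
     mat (card I) (card I) (\<lambda>(r,s). A $$ (pick I r, pick I s) / A $$ (pick I r, pick I r))"
proof -
  have idx: "submatrix A I I $$ (r,s) = A $$ (pick I r, pick I s)"
    if "r < card I" "s < card I" for r s
    using that by (simp add: submatrix_principal[OF A I])
  have "submatrix A I I \<in> carrier_mat (card I) (card I)" by (simp add: submatrix_principal[OF A I])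
  then have "inv_mat (diag_part (submatrix A I I)) * submatrix A I I =
      mat (card I) (card I) (\<lambda>(r,s). submatrix A I I $$ (r,s) / submatrix A I I $$ (r,r))"
    by (rule inv_mat_diag_mult) (simp add: idx diag_pick_nonzero)
  also have "\<dots> = mat (card I) (card I) (\<lambda>(r,s). A $$ (pick I r, pick I s) / A $$ (pick I r, pick I r))"
    by (rule cong_mat) (simp_all add: idx)
  finally show ?thesis .
qed

lemma irreducible_submatrix_iff:
  "irreducible_mat (submatrix A I I) \<longleftrightarrow> irred_on (\<lambda>i j. A $$ (i,j)) I"
proof -
  have "irreducible_mat (submatrix A I I) \<longleftrightarrow>
      irred_on (\<lambda>r s. submatrix A I I $$ (r,s)) {..<card I}"
    by (rule irreducible_mat_iff_irred_on) (simp add: submatrix_principal[OF A I])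
  also have "\<dots> \<longleftrightarrow> irred_on (\<lambda>r s. A $$ (pick I r, pick I s)) {..<card I}"
    unfolding irred_on_def submatrix_principal[OF A I]
    by (intro arg_cong[where f = Not] ex_cong1) (auto simp: subset_eq psubset_eq)
  also have "\<dots> \<longleftrightarrow> irred_on (\<lambda>i j. A $$ (i,j)) I"
    by (rule irred_on_reindex[OF bij_betw_pick[OF finite_subset[OF I finite_lessThan]], of "\<lambda>i j. A $$ (i,j)"])
  finally show ?thesis .
qed

lemma equi_submatrix_iff:
  "equi_on (\<lambda>r s. submatrix A I I $$ (r,s)) \<beta> {..<card I} \<longleftrightarrow>
    equi_on (\<lambda>r s. A $$ (pick I r, pick I s)) \<beta> {..<card I}"
  unfolding submatrix_principal[OF A I] by (simp add: equi_on_def)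

lemma equi_scaled_submatrix_iff:
  "equi_on (\<lambda>r s. (inv_mat (diag_part (submatrix A I I)) * submatrix A I I) $$ (r,s)) \<beta> {..<card I} \<longleftrightarrow>
    equi_on (\<lambda>r s. A $$ (pick I r, pick I s)) \<beta> {..<card I}"
proof -
  have "equi_on (\<lambda>r s. (inv_mat (diag_part (submatrix A I I)) * submatrix A I I) $$ (r,s)) \<beta> {..<card I} \<longleftrightarrow>
      equi_on (\<lambda>r s. A $$ (pick I r, pick I s) / A $$ (pick I r, pick I r)) \<beta> {..<card I}"
    unfolding scaled_submatrix by (simp add: equi_on_def)
  also have "\<dots> \<longleftrightarrow> equi_on (\<lambda>r s. A $$ (pick I r, pick I s)) \<beta> {..<card I}"
    by (rule equi_on_row_scale) (use diag_pick_nonzero in simp)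
  finally show ?thesis .
qed

text \<open>Condition (i) of the criterion speaks of the submatrix, condition (ii) of its diagonally
  scaled form. Row scaling preserves equipotency, so both reduce to the same predicate of
  \<open>I\<close>.\<close>

lemma submatrix_GDE_iff:
  "submatrix A I I \<in> GDE_mats (card I) \<longleftrightarrow>
     (\<exists>\<beta>. (\<forall>i\<in>I. \<beta> i > 0) \<and> equi_on (\<lambda>i j. A $$ (i,j)) \<beta> I)"
  "inv_mat (diag_part (submatrix A I I)) * submatrix A I I \<in> GDE_mats (card I) \<longleftrightarrow>
     (\<exists>\<beta>. (\<forall>i\<in>I. \<beta> i > 0) \<and> equi_on (\<lambda>i j. A $$ (i,j)) \<beta> I)"
proof -
  note reindex = ex_equi_on_reindex[OF bij_betw_pick[OF finite_subset[OF I finite_lessThan]], of "\<lambda>i j. A $$ (i,j)"]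
  show "submatrix A I I \<in> GDE_mats (card I) \<longleftrightarrow>
     (\<exists>\<beta>. (\<forall>i\<in>I. \<beta> i > 0) \<and> equi_on (\<lambda>i j. A $$ (i,j)) \<beta> I)"
    by (subst GDE_mats_iff_equi_on)
      (simp_all only: equi_submatrix_iff reindex, simp add: submatrix_principal[OF A I])
  show "inv_mat (diag_part (submatrix A I I)) * submatrix A I I \<in> GDE_mats (card I) \<longleftrightarrow>
     (\<exists>\<beta>. (\<forall>i\<in>I. \<beta> i > 0) \<and> equi_on (\<lambda>i j. A $$ (i,j)) \<beta> I)"
    by (subst GDE_mats_iff_equi_on)
      (simp_all only: equi_scaled_submatrix_iff reindex, simp add: scaled_submatrix)
qed

lemma submatrix_DE_iff:
  "submatrix A I I \<in> DE_mats (card I) \<longleftrightarrow> equi_on (\<lambda>i j. A $$ (i,j)) (\<lambda>_. 1) I"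
  "inv_mat (diag_part (submatrix A I I)) * submatrix A I I \<in> DE_mats (card I) \<longleftrightarrow>
     equi_on (\<lambda>i j. A $$ (i,j)) (\<lambda>_. 1) I"
proof -
  have reindex: "equi_on (\<lambda>r s. A $$ (pick I r, pick I s)) (\<lambda>_. 1) {..<card I} \<longleftrightarrow>
      equi_on (\<lambda>i j. A $$ (i,j)) (\<lambda>_. 1) I"
    using equi_on_reindex[OF bij_betw_pick[OF finite_subset[OF I finite_lessThan]], of "\<lambda>i j. A $$ (i,j)" "\<lambda>_. 1"]
    by (simp add: comp_def)
  show "submatrix A I I \<in> DE_mats (card I) \<longleftrightarrow> equi_on (\<lambda>i j. A $$ (i,j)) (\<lambda>_. 1) I"
    by (subst DE_mats_iff_equi_on)
      (simp_all only: equi_submatrix_iff reindex, simp add: submatrix_principal[OF A I])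
  show "inv_mat (diag_part (submatrix A I I)) * submatrix A I I \<in> DE_mats (card I) \<longleftrightarrow>
     equi_on (\<lambda>i j. A $$ (i,j)) (\<lambda>_. 1) I"
    by (subst DE_mats_iff_equi_on)
      (simp_all only: equi_scaled_submatrix_iff reindex, simp add: scaled_submatrix)
qed

text \<open>Scaling makes the diagonal 1, as \<open>L_ray_iff_aligned_on\<close> requires;
  invariance under row scaling and under the increasing enumeration \<open>pick I\<close> then
  carries alignment over to \<open>I\<close>.\<close>

lemma scaled_submatrix_L_ray_iff:
  assumes "I \<noteq> {}"
  shows "inv_mat (diag_part (submatrix A I I)) * submatrix A I I \<in> L_ray \<phi> (card I) \<longleftrightarrow>
    aligned_on (\<lambda>i j. A $$ (i,j)) \<phi> I"
proof -
  have k: "0 < card I" using assms finite_subset[OF I finite_lessThan] by (simp add: card_gt_0_iff)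
  let ?B = "inv_mat (diag_part (submatrix A I I)) * submatrix A I I"
  have "?B \<in> L_ray \<phi> (card I) \<longleftrightarrow> aligned_on (\<lambda>r s. ?B $$ (r,s)) \<phi> {..<card I}"
    by (rule L_ray_iff_aligned_on[OF _ k]) (use diag_pick_nonzero in \<open>simp_all add: scaled_submatrix\<close>)
  also have "\<dots> \<longleftrightarrow>
      aligned_on (\<lambda>r s. A $$ (pick I r, pick I s) / A $$ (pick I r, pick I r)) \<phi> {..<card I}"
    unfolding scaled_submatrix by (simp add: aligned_on_def)
  also have "\<dots> \<longleftrightarrow> aligned_on (\<lambda>r s. A $$ (pick I r, pick I s)) \<phi> {..<card I}"
    by (rule aligned_on_row_scale) (use diag_pick_nonzero in simp)
  also have "\<dots> \<longleftrightarrow> aligned_on (\<lambda>i j. A $$ (i,j)) \<phi> I"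
    by (rule aligned_on_reindex[OF bij_betw_pick[OF finite_subset[OF I finite_lessThan]] strict_mono_on_pick, of "\<lambda>i j. A $$ (i,j)"])
  finally show ?thesis .
qed

end

section \<open>The criterion on the spectral radius\<close>

text \<open>\<open>E\<close> stands for either notion of equipotency, with unit weights or with
  freely chosen ones. It is bracketed: equality with the dominance weights \<open>\<alpha>\<close>
  implies \<open>E\<close>, and \<open>E\<close> implies equality with some positive weights. Each
  direction of the proof uses one of the two.\<close>

lemma spectral_radius_H_BGS_ge_1_iff:
  fixes A :: "complex mat"
  assumes n: "n \<ge> 1" and A: "A \<in> carrier_mat n n" and nz: "\<And>i. i < n \<Longrightarrow> A $$ (i,i) \<noteq> 0"
    and pos: "\<And>i. i < n \<Longrightarrow> \<alpha> i > 0" and dom: "dominant_on (\<lambda>i j. A $$ (i,j)) \<alpha> {..<n}"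
    and E_imp: "\<And>I. E I \<Longrightarrow> \<exists>\<beta>. (\<forall>i\<in>I. \<beta> i > 0) \<and> equi_on (\<lambda>i j. A $$ (i,j)) \<beta> I"
    and imp_E: "\<And>I. I \<subseteq> {..<n} \<Longrightarrow> equi_on (\<lambda>i j. A $$ (i,j)) \<alpha> I \<Longrightarrow> E I"
  shows "1 \<le> spectral_radius (H_BGS A) \<longleftrightarrow>
    (\<exists>I \<phi>. I \<subseteq> {..<n} \<and> 2 \<le> card I \<and> irred_on (\<lambda>i j. A $$ (i,j)) I \<and> E I \<and>
       aligned_on (\<lambda>i j. A $$ (i,j)) \<phi> I)" (is "?l \<longleftrightarrow> ?r")
proof
  have H: "H_BGS A \<in> carrier_mat n n" by (rule H_BGS_carrier[OF A nz])
  let ?a = "\<lambda>i j. A $$ (i,j)"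
  {
    assume ?l
    moreover obtain \<mu> where mu: "eigenvalue (H_BGS A) \<mu>" "cmod \<mu> = spectral_radius (H_BGS A)"
      using spectral_radius_mem_max(1)[OF H] n by (auto simp: spectrum_def)
    ultimately have mu1: "1 \<le> cmod \<mu>" by simp
    then have "\<mu> \<noteq> 0" by auto
    then have "det (twist_mat (1 / \<mu>) A) = 0" using eigenvalue_H_BGS_iff[OF A nz] mu(1) by blast
    then obtain v where v: "v \<in> carrier_vec n" "v \<noteq> 0\<^sub>v n" "twist_mat (1 / \<mu>) A *\<^sub>v v = 0\<^sub>v n"
      using det_0_iff_vec_prod_zero[OF twist_mat_carrier[OF A]] by blast
    obtain k where k: "k < n" "v $ k \<noteq> 0"
      using v by (metis carrier_vecD eq_vecI index_zero_vec(1) index_zero_vec(2))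
    have ker: "(\<Sum>j<n. lower_twist (1 / \<mu>) i j * ?a i j * v $ j) = 0" if i: "i < n" for i
    proof -
      have "(\<Sum>j<n. lower_twist (1 / \<mu>) i j * ?a i j * v $ j) = (twist_mat (1 / \<mu>) A *\<^sub>v v) $ i"
        using A v(1) i by (simp add: twist_mat_def scalar_prod_def atLeast0LessThan)
      then show ?thesis using v(3) i by simp
    qed
    have le: "cmod (1 / \<mu>) \<le> 1" using mu1 by (simp add: norm_divide divide_le_eq)
    obtain I \<phi> where "I \<subseteq> {..<n}" "2 \<le> card I" "irred_on ?a I" "equi_on ?a \<alpha> I" "aligned_on ?a \<phi> I"
      using twisted_kernel_imp_aligned_component[of n ?a \<alpha> "1 / \<mu>" k "\<lambda>j. v $ j", OF nz pos dom le k ker]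
      by blast
    then show ?r using imp_E by blast
  }
  assume ?r
  then obtain I \<phi> where I: "I \<subseteq> {..<n}" "2 \<le> card I" "irred_on ?a I" "E I" "aligned_on ?a \<phi> I" by blast
  have ne: "I \<noteq> {}" using I(2) by auto
  obtain \<beta> where b: "\<And>i. i \<in> I \<Longrightarrow> \<beta> i > 0" "equi_on ?a \<beta> I" using E_imp[OF I(4)] by blast
  \<comment> \<open>The weights \<open>\<beta>\<close> obtained from \<open>E\<close> may differ
    from \<open>\<alpha>\<close>; comparing the two on the irreducible set \<open>I\<close> excludes
    entries leaving it.\<close>
  have closed: "?a i j = 0" if "i \<in> I" "j < n" "j \<notin> I" for i j
    by (rule equi_component_closed[of n \<alpha> ?a I \<beta>, OF pos dom I(1) ne I(3) b(2,1) that])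
  from aligned_component_imp_twisted_singular[of n ?a I \<beta> \<phi>, OF nz I(1) ne closed b(2,1) I(5)]
  have "det (mat n n (\<lambda>(i,j). lower_twist (cis (- \<phi>)) i j * ?a i j)) = 0" .
  moreover have "1 / cis \<phi> = cis (- \<phi>)" by (simp add: divide_inverse)
  ultimately have "det (twist_mat (1 / cis \<phi>) A) = 0" using A by (simp add: twist_mat_def)
  then have "eigenvalue (H_BGS A) (cis \<phi>)" using eigenvalue_H_BGS_iff[OF A nz, of "cis \<phi>"] by simp
  then show ?l using spectral_radius_mem_max(2)[OF H, of "cmod (cis \<phi>)"] n by (force simp: spectrum_def)
qed

text \<open>The obstructing components split by order: for pairs a suitable \<open>\<phi>\<close>
  always exists, and from order three on alignment is the ray pattern condition. \<open>M\<close> is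
  the matrix class that \<open>E\<close> describes on index sets.\<close>

lemma spectral_radius_H_BGS_less_1_iff:
  fixes A :: "complex mat"
  assumes n: "n \<ge> 1" and A: "A \<in> carrier_mat n n" and nz: "\<And>i. i < n \<Longrightarrow> A $$ (i,i) \<noteq> 0"
    and pos: "\<And>i. i < n \<Longrightarrow> \<alpha> i > 0" and dom: "dominant_on (\<lambda>i j. A $$ (i,j)) \<alpha> {..<n}"
    and E_imp: "\<And>I. E I \<Longrightarrow> \<exists>\<beta>. (\<forall>i\<in>I. \<beta> i > 0) \<and> equi_on (\<lambda>i j. A $$ (i,j)) \<beta> I"
    and imp_E: "\<And>I. I \<subseteq> {..<n} \<Longrightarrow> equi_on (\<lambda>i j. A $$ (i,j)) \<alpha> I \<Longrightarrow> E I"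
    and sub: "\<And>I. I \<subseteq> {..<n} \<Longrightarrow> submatrix A I I \<in> M (card I) \<longleftrightarrow> E I"
    and scaled: "\<And>I. I \<subseteq> {..<n} \<Longrightarrow>
        inv_mat (diag_part (submatrix A I I)) * submatrix A I I \<in> M (card I) \<longleftrightarrow> E I"
  shows "spectral_radius (H_BGS A) < 1 \<longleftrightarrow>
     \<not> (\<exists>I\<subseteq>{..<n}. card I = 2 \<and> irreducible_mat (submatrix A I I) \<and> submatrix A I I \<in> M 2)
   \<and> \<not> (\<exists>k I. 3 \<le> k \<and> k \<le> n \<and> I \<subseteq> {..<n} \<and> card I = k \<and> irreducible_mat (submatrix A I I) \<and>
          (\<exists>\<phi>. inv_mat (diag_part (submatrix A I I)) * submatrix A I I \<in> L_ray \<phi> k \<inter> M k))"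
    (is "_ \<longleftrightarrow> \<not> ?two \<and> \<not> ?more")
proof -
  let ?a = "\<lambda>i j. A $$ (i,j)"
  let ?bad = "\<exists>I \<phi>. I \<subseteq> {..<n} \<and> 2 \<le> card I \<and> irred_on ?a I \<and> E I \<and> aligned_on ?a \<phi> I"
  have two: "?two \<longleftrightarrow> (\<exists>I \<phi>. I \<subseteq> {..<n} \<and> card I = 2 \<and> irred_on ?a I \<and> E I \<and> aligned_on ?a \<phi> I)"
  proof -
    have "(card I = 2 \<and> irreducible_mat (submatrix A I I) \<and> submatrix A I I \<in> M 2) \<longleftrightarrow>
        (card I = 2 \<and> irred_on ?a I \<and> E I \<and> (\<exists>\<phi>. aligned_on ?a \<phi> I))" if I: "I \<subseteq> {..<n}" for I
    proof -
      have "\<exists>\<phi>. aligned_on ?a \<phi> I" if c: "card I = 2" and "E I"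
      proof -
        obtain \<beta> where b: "\<And>i. i \<in> I \<Longrightarrow> \<beta> i > 0" "equi_on ?a \<beta> I" using E_imp[OF \<open>E I\<close>] by blast
        have "?a i i \<noteq> 0" if "i \<in> I" for i using nz that I by auto
        from equi_on_pair_imp_aligned[of I ?a \<beta>, OF c this b(2,1)] show ?thesis by blast
      qed
      then show ?thesis using irreducible_submatrix_iff[OF A nz I] sub[OF I] by auto
    qed
    then show ?thesis by blast
  qed
  have card_le: "card I \<le> n" if "I \<subseteq> {..<n}" for I
    using card_mono[OF finite_lessThan that] by simp
  \<comment> \<open>The order \<open>k\<close> is the cardinality of \<open>I\<close> and hence at
    most \<open>n\<close>, so it can be eliminated.\<close>
  have order_eq: "(\<exists>k I. 3 \<le> k \<and> k \<le> n \<and> I \<subseteq> {..<n} \<and> card I = k \<and> R I k) \<longleftrightarrow>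
      (\<exists>I\<subseteq>{..<n}. 3 \<le> card I \<and> R I (card I))" for R
    using card_le by auto
  have order_cases: "(\<exists>I \<phi>. P I \<and> 2 \<le> card I \<and> Q I \<phi>) \<longleftrightarrow>
      (\<exists>I \<phi>. P I \<and> card I = 2 \<and> Q I \<phi>) \<or> (\<exists>I \<phi>. P I \<and> 3 \<le> card I \<and> Q I \<phi>)"
    for P :: "nat set \<Rightarrow> bool" and Q :: "nat set \<Rightarrow> real \<Rightarrow> bool"
  proof -
    have "2 \<le> c \<longleftrightarrow> c = 2 \<or> 3 \<le> c" for c :: nat by linarith
    then show ?thesis by blast
  qed
  have ex_conj_eq: "(\<exists>I. P I \<and> C I \<and> R I \<and> (\<exists>\<phi>. Q I \<phi> \<and> F I)) \<longleftrightarrow>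
      (\<exists>I \<phi>. P I \<and> C I \<and> R I \<and> F I \<and> Q I \<phi>)"
    for P C R F :: "nat set \<Rightarrow> bool" and Q :: "nat set \<Rightarrow> real \<Rightarrow> bool"
    by blast
  have more: "?more \<longleftrightarrow> (\<exists>I \<phi>. I \<subseteq> {..<n} \<and> 3 \<le> card I \<and> irred_on ?a I \<and> E I \<and> aligned_on ?a \<phi> I)"
  proof -
    have "?more \<longleftrightarrow> (\<exists>I\<subseteq>{..<n}. 3 \<le> card I \<and> irreducible_mat (submatrix A I I) \<and>
          (\<exists>\<phi>. inv_mat (diag_part (submatrix A I I)) * submatrix A I I \<in> L_ray \<phi> (card I) \<inter> M (card I)))"
      by (rule order_eq)
    also have "\<dots> \<longleftrightarrow> (\<exists>I\<subseteq>{..<n}. 3 \<le> card I \<and> irred_on ?a I \<and> (\<exists>\<phi>. aligned_on ?a \<phi> I \<and> E I))"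
    proof (intro ex_cong1 conj_cong refl)
      fix I assume I: "I \<subseteq> {..<n}" and c: "3 \<le> card I"
      show "irreducible_mat (submatrix A I I) = irred_on ?a I"
        by (rule irreducible_submatrix_iff[OF A nz I])
      have "I \<noteq> {}" using c by auto
      fix \<phi>
      show "inv_mat (diag_part (submatrix A I I)) * submatrix A I I \<in> L_ray \<phi> (card I) \<inter> M (card I) \<longleftrightarrow>
          aligned_on ?a \<phi> I \<and> E I"
        using scaled_submatrix_L_ray_iff[OF A nz I \<open>I \<noteq> {}\<close>] scaled[OF I] by simp
    qed
    also have "\<dots> \<longleftrightarrow> (\<exists>I \<phi>. I \<subseteq> {..<n} \<and> 3 \<le> card I \<and> irred_on ?a I \<and> E I \<and> aligned_on ?a \<phi> I)"
      by (rule ex_conj_eq)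
    finally show ?thesis .
  qed
  have "1 \<le> spectral_radius (H_BGS A) \<longleftrightarrow> ?bad"
    by (rule spectral_radius_H_BGS_ge_1_iff[OF n A nz pos dom E_imp imp_E])
  then have "spectral_radius (H_BGS A) < 1 \<longleftrightarrow> \<not> ?bad" by (simp only: not_le[symmetric])
  moreover have "?bad \<longleftrightarrow> ?two \<or> ?more"
    unfolding two more by (rule order_cases)
  ultimately show ?thesis by (simp only: de_Morgan_disj)
qed

theorem theorem4p21:
  fixes n :: nat and A :: "complex mat"
  assumes "n \<ge> 1"
    and "A \<in> carrier_mat n n"
    and "\<forall>i<n. A $$ (i,i) \<noteq> 0"
  shows
    "(A \<in> D_mats n \<longrightarrow>
       (spectral_radius (H_BGS A) < 1 \<longleftrightarrow>
          \<not> (\<exists>I\<subseteq>{..<n}. card I = 2 \<and> irreducible_mat (submatrix A I I) \<and>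
                submatrix A I I \<in> DE_mats 2)
        \<and> \<not> (\<exists>k I. 3 \<le> k \<and> k \<le> n \<and> I \<subseteq> {..<n} \<and> card I = k \<and>
                irreducible_mat (submatrix A I I) \<and>
                (\<exists>\<phi>. inv_mat (diag_part (submatrix A I I)) * submatrix A I I
                       \<in> L_ray \<phi> k \<inter> DE_mats k)))
     \<and> (\<forall>b\<in>carrier_vec n. spectral_radius (H_BGS A) < 1 \<longleftrightarrow> bgs_convergent n A b))
   \<and> (A \<in> GD_mats n \<longrightarrow>
       (spectral_radius (H_BGS A) < 1 \<longleftrightarrow>
          \<not> (\<exists>I\<subseteq>{..<n}. card I = 2 \<and> irreducible_mat (submatrix A I I) \<and>
                submatrix A I I \<in> GDE_mats 2)
        \<and> \<not> (\<exists>k I. 3 \<le> k \<and> k \<le> n \<and> I \<subseteq> {..<n} \<and> card I = k \<and>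
                irreducible_mat (submatrix A I I) \<and>
                (\<exists>\<phi>. inv_mat (diag_part (submatrix A I I)) * submatrix A I I
                       \<in> L_ray \<phi> k \<inter> GDE_mats k)))
     \<and> (\<forall>b\<in>carrier_vec n. spectral_radius (H_BGS A) < 1 \<longleftrightarrow> bgs_convergent n A b))"
proof -
  note n = assms(1) and A = assms(2)
  have nz: "\<And>i. i < n \<Longrightarrow> A $$ (i,i) \<noteq> 0" using assms(3) by blast
  let ?a = "\<lambda>i j. A $$ (i,j)"
  have conv: "\<forall>b\<in>carrier_vec n. spectral_radius (H_BGS A) < 1 \<longleftrightarrow> bgs_convergent n A b"
    using bgs_convergent_iff[OF n A nz] by blast
  show ?thesis
  proof (intro conjI impI conv)
    assume "A \<in> D_mats n"
    then have dom: "dominant_on ?a (\<lambda>_. 1) {..<n}" by (simp add: D_mats_def dominant_on_def)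
    have E: "\<exists>\<beta>. (\<forall>i\<in>I. \<beta> i > 0) \<and> equi_on ?a \<beta> I" if "equi_on ?a (\<lambda>_. 1) I" for I
      using that by (intro exI[of _ "\<lambda>_. 1"]) simp
    show "spectral_radius (H_BGS A) < 1 \<longleftrightarrow>
          \<not> (\<exists>I\<subseteq>{..<n}. card I = 2 \<and> irreducible_mat (submatrix A I I) \<and>
                submatrix A I I \<in> DE_mats 2)
        \<and> \<not> (\<exists>k I. 3 \<le> k \<and> k \<le> n \<and> I \<subseteq> {..<n} \<and> card I = k \<and>
                irreducible_mat (submatrix A I I) \<and>
                (\<exists>\<phi>. inv_mat (diag_part (submatrix A I I)) * submatrix A I I
                       \<in> L_ray \<phi> k \<inter> DE_mats k))"
      by (rule spectral_radius_H_BGS_less_1_iff[of n A "\<lambda>_. 1" "equi_on ?a (\<lambda>_. 1)" DE_mats, OF n A nz _ dom E])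
        (simp_all add: submatrix_DE_iff[OF A nz])
  next
    assume "A \<in> GD_mats n"
    then obtain \<alpha> :: "nat \<Rightarrow> real" where pos: "\<And>i. i < n \<Longrightarrow> \<alpha> i > 0" and dom: "dominant_on ?a \<alpha> {..<n}"
      unfolding GD_mats_def dominant_on_def by auto
    \<comment> \<open>The weights in \<open>GDE_mats\<close> are chosen anew for each submatrix, so
      \<open>?E\<close> quantifies over them rather than fixing the global
      \<open>\<alpha>\<close>.\<close>
    let ?E = "\<lambda>I. \<exists>\<beta>. (\<forall>i\<in>I. \<beta> i > 0) \<and> equi_on ?a \<beta> I"
    have imp_E: "?E I" if "I \<subseteq> {..<n}" "equi_on ?a \<alpha> I" for I
      using that pos by (intro exI[of _ \<alpha>]) auto
    show "spectral_radius (H_BGS A) < 1 \<longleftrightarrow>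
          \<not> (\<exists>I\<subseteq>{..<n}. card I = 2 \<and> irreducible_mat (submatrix A I I) \<and>
                submatrix A I I \<in> GDE_mats 2)
        \<and> \<not> (\<exists>k I. 3 \<le> k \<and> k \<le> n \<and> I \<subseteq> {..<n} \<and> card I = k \<and>
                irreducible_mat (submatrix A I I) \<and>
                (\<exists>\<phi>. inv_mat (diag_part (submatrix A I I)) * submatrix A I I
                       \<in> L_ray \<phi> k \<inter> GDE_mats k))"
      by (rule spectral_radius_H_BGS_less_1_iff[of n A \<alpha> ?E GDE_mats, OF n A nz pos dom _ imp_E])
        (simp_all only: submatrix_GDE_iff[OF A nz])
  qed
qed

end
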